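(* Let $Z\in\mathcal Z$ and $\mu\in\mathcal F_Z$. There exists a family $\mathcal D^Z=\{P\in\mathcal D^Z_k:k\in\mathbb Z\}$ such that for each $k\in\mathbb Z$, $\mathcal D^Z_k$ consists of pairwise disjoint admissible cylinders, and the following hold: (i) $\mu\big(G\setminus\bigsqcup_{P\in\mathcal D^Z_k}P\big)=0$ for every $k\in\mathbb Z$; (ii) for every $P\in\mathcal D^Z_k$ there exists a unique cylinder $p(P)\in\mathcal D^Z_{k-1}$ such that $P\subset p(P)$, while $P\cap P'=\emptyset$ for any other $P'\in\mathcal D^Z_{k-1}$; (iii) for almost every $x\in G$ there is, for every $k\in\mathbb Z$, a (necessarily unique) cylinder $P^x_k\in\mathcal D^Z_k$ containing $x$, and for any such $x$ $$\lim_{k\to-\infty}\mu(P^x_k)=+\infty,\qquad \lim_{k\to+\infty}\mu(P^x_k)=0;$$ (iv) for every $P\in\mathcal D^Z$, $\mu(p(P))\le C_1\mu(P)$ and $\#\{P'\in\mathcal D^Z:P=p(P')\}\le C_1$.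
   Context: **Group setting.** $N$ is a stratified Lie group of step $S\ge 1$: simply connected, with Lie algebra $\mathfrak n=\bigoplus_{j=1}^S\mathfrak n_j$, $[\mathfrak n_i,\mathfrak n_j]\subset\mathfrak n_{i+j}$ (with $\mathfrak n_l=0$ for $l>S$), $\mathfrak n_1$ generating $\mathfrak n$. $dn$ is the Haar measure on $N$ (push-forward of Lebesgue measure by $\exp_N$). $A=(\mathbb R_+,\cdot)$ acts on $N$ by the automorphic dilations $D_a(\exp_N(\sum_j Y_j))=\exp_N(\sum_j a^jY_j)$, $Y_j\in\mathfrak n_j$. $G=N\rtimes A$ has product $(n,a)(n',a')=(nD_a(n'),aa')$ and right Haar measure $d\rho(n,a)=a^{-1}\,dn\,da$. Fix bases $\{\breve X_{j,i}:1\le i\le q_j\}$ of $\mathfrak n_j$. $d_N$ is the (left-invariant) Carnot–Carathéodory distance on $N$ for which $\breve X_{1,1},\dots,\breve X_{1,q_1}$ is an orthonormal horizontal frame. In the Lie algebra $\mathfrak g=\mathfrak n\oplus\mathfrak a$ of $G$, $X_0$ is the generator of $A$ with $\exp(tX_0)=(1_N,e^t)$, and $X_{j,i}$ is the left-invariant vector field on $G$ whose value at the identity is $\breve X_{j,i}$. $\langle\cdot,\cdot\rangle$ is the scalar product on $\mathfrak g$ making $\{X_0\}\cup\{X_{j,i}\}_{j,i}$ orthonormal, and $\mathcal Z=\{Z\in\mathfrak g:\langle Z,X_0\rangle=1\}$. **Flow measures.** A Borel measure $\mu$ on $G$ is a $Z$-flow measure if $d\mu=\varphi\,d\rho$ with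 $\varphi:G\to[0,\infty)$ satisfying $\varphi(x)=\varphi(x\exp(tZ))$ for all $x\in G$, $t\in\mathbb R$. Put $\mu_N(F)=\int_F\varphi(n,1)\,dn$ for Borel $F\subset N$. $\mathcal F_Z$ is the set of $Z$-flow measures $\mu$ such that $(N,d_N,\mu_N)$ is doubling, i.e. balls have positive finite measure and for every $C>1$ there is $D(\mu_N,C)>1$ with $\mu_N(B(x,Cr))\le D(\mu_N,C)\mu_N(B(x,r))$ for all $x\in N$, $r>0$. **Christ cubes.** For $\mu\in\mathcal F_Z$, fix a Christ decomposition of $(N,d_N,\mu_N)$: families $\mathcal Q_k$ ($k\in\mathbb Z$) of countably many pairwise disjoint open sets of $N$ ("cubes of generation $k$"), $\mathcal Q=\bigcup_k\mathcal Q_k$, and constants $\delta\in(0,1)$, $C_1,c>0$ such that: (i) $\mu_N(N\setminus\bigcup_{Q\in\mathcal Q_k}Q)=0$ for all $k$; (ii) each $Q\in\mathcal Q_k$ is contained in a unique $p_N(Q)\in\mathcal Q_{k-1}$ and is disjoint from every other element of $\mathcal Q_{k-1}$; (iii) for each $Q\in\mathcal Q_k$ there is $n_Q\in Q$ with $B_N(n_Q,c\delta^k)\subset Q\subset B_N(n_Q,C_1\delta^k)$; (iv) $\mu_N(p_N(Q))\le C_1\mu_N(Q)$ and $s_N(Q):=\{Q'\in\mathcal Q:p_N(Q')=Q\}$ has at most $C_1$ elements. It is assumed that $C_1\ge3$ and $\#s_N(Q)\ge2$ for all $Q$. The constant $C_1$ in the claim is this one. **Cylinders.** For $E\subset N$,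 $r>1$, $a\in A$: $P_{r,E}(a)=\{(n,1)\exp(tZ):n\in E,\ t\in U_r(a)\}$, $U_r(a)=(\log(a/r),\log(ar))$. Fix $\gamma\ge5$ and $\lambda>e^3/\delta$. $P_{r,Q}(a)$ with $Q\in\mathcal Q_k$ is *admissible* if either $r>e$ and $ar^2\le\delta^k\le\lambda ar^\gamma$ ( *large* ), or $1<r\le e$ and $ae^2\log r\le\delta^k\le\lambda ae^2\log r$ ( *small* ). *)

theory Defs
  imports "HOL-Analysis.Analysis"
begin

section \<open>Stratified groups in exponential coordinates\<close>

text \<open>
  A simply connected nilpotent Lie group \<open>N\<close> is identified with its Lie algebra through the
  (bijective) exponential map.  Thus the carrier of \<open>N\<close> is a finite-dimensional real vector space
  \<open>'a\<close>, the map \<open>exp\<^sub>N\<close> is the identity, \<open>1\<^sub>N = 0\<close>, and the Haar measure (push-forward of Lebesgue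
  measure under \<open>exp\<^sub>N\<close>) is \<^term>\<open>lborel\<close>.  The inner product of \<open>'a\<close> has no role except for
  normalizing \<^term>\<open>lborel\<close>; the bases below need not be orthonormal for it.
\<close>

record 'a stratified =
  mul :: "'a \<Rightarrow> 'a \<Rightarrow> 'a"
  step :: nat
  layer :: "nat \<Rightarrow> 'a set"           \<comment> \<open>the subspaces \<open>\<nn>\<^sub>j\<close>, \<open>1 \<le> j \<le> S\<close>\<close>
  ldim :: "nat \<Rightarrow> nat"               \<comment> \<open>\<open>q\<^sub>j\<close>\<close>
  frame :: "nat \<Rightarrow> nat \<Rightarrow> 'a"         \<comment> \<open>the basis vector \<open>X\<^sub>j\<^sub>,\<^sub>i\<close> of \<open>\<nn>\<^sub>j\<close>, \<open>1 \<le> i \<le> q\<^sub>j\<close>\<close>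

primrec Ck_map :: "nat \<Rightarrow> ('a::real_normed_vector \<Rightarrow> 'b::real_normed_vector) \<Rightarrow> bool" where
  "Ck_map 0 f \<longleftrightarrow> continuous_on UNIV f"
| "Ck_map (Suc k) f \<longleftrightarrow>
     (\<forall>x. f differentiable (at x)) \<and> (\<forall>v. Ck_map k (\<lambda>x. frechet_derivative f (at x) v))"

definition smooth_map :: "('a::real_normed_vector \<Rightarrow> 'b::real_normed_vector) \<Rightarrow> bool" where
  "smooth_map f \<longleftrightarrow> (\<forall>k. Ck_map k f)"

text \<open>The left-invariant vector field on \<open>N\<close> with value \<open>v\<close> at the identity.\<close>

definition left_field :: "'a::euclidean_space stratified \<Rightarrow> 'a \<Rightarrow> 'a \<Rightarrow> 'a" where
  "left_field N v x = frechet_derivative (mul N x) (at 0) v"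

text \<open>The Lie bracket: value at the identity of the commutator \<open>[U,V] = DV\<cdot>U - DU\<cdot>V\<close> of
  left-invariant vector fields.\<close>

definition lie_bracket :: "'a::euclidean_space stratified \<Rightarrow> 'a \<Rightarrow> 'a \<Rightarrow> 'a" where
  "lie_bracket N u v =
     frechet_derivative (left_field N v) (at 0) u - frechet_derivative (left_field N u) (at 0) v"

definition layer_decomp :: "'a::euclidean_space stratified \<Rightarrow> 'a \<Rightarrow> (nat \<Rightarrow> 'a) \<Rightarrow> bool" where
  "layer_decomp N x y \<longleftrightarrow>
     (\<forall>j. if j \<in> {1..step N} then y j \<in> layer N j else y j = 0) \<and> x = (\<Sum>j=1..step N. y j)"

definition dil :: "'a::euclidean_space stratified \<Rightarrow> real \<Rightarrow> 'a \<Rightarrow> 'a" where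
  "dil N a x = (\<Sum>j=1..step N. a ^ j *\<^sub>R (THE y. layer_decomp N x y) j)"

text \<open>
  The condition \<open>one_parameter\<close> says that \<open>t \<mapsto> t x\<close> is the one-parameter subgroup with velocity
  \<open>x\<close> at the identity, i.e. that \<open>exp\<^sub>N\<close> is the identity map.  The condition \<open>automorphic\<close>, part of
  the setting (\<open>A\<close> acts on \<open>N\<close> by automorphisms), is also a consequence of the other ones, since
  every \<^term>\<open>dil N a\<close> is an automorphism of the Lie algebra.
\<close>

locale stratified_group =
  fixes N :: "'a::euclidean_space stratified"
  assumes group: "group (mul N) 0 uminus"
    and smooth: "smooth_map (\<lambda>(x, y). mul N x y)"
    and one_parameter: "mul N (s *\<^sub>R x) (t *\<^sub>R x) = (s + t) *\<^sub>R x"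
    and step_ge_1: "step N \<ge> 1"
    and layer_subspace: "j \<in> {1..step N} \<Longrightarrow> subspace (layer N j)"
    and top_layer: "layer N (step N) \<noteq> {0}"
    and beyond_step: "l > step N \<Longrightarrow> layer N l = {0}"
    and direct_sum: "\<exists>!y. layer_decomp N x y"
    and bracket_layer: "\<lbrakk>i \<ge> 1; j \<ge> 1; u \<in> layer N i; v \<in> layer N j\<rbrakk>
                          \<Longrightarrow> lie_bracket N u v \<in> layer N (i + j)"
    and generating: "\<lbrakk>subspace W; layer N 1 \<subseteq> W; \<And>u v. \<lbrakk>u \<in> W; v \<in> W\<rbrakk> \<Longrightarrow> lie_bracket N u v \<in> W\<rbrakk>
                          \<Longrightarrow> W = UNIV"
    and frame_inj: "j \<in> {1..step N} \<Longrightarrow> inj_on (frame N j) {1..ldim N j}"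
    and frame_indep: "j \<in> {1..step N} \<Longrightarrow> independent (frame N j ` {1..ldim N j})"
    and frame_span: "j \<in> {1..step N} \<Longrightarrow> span (frame N j ` {1..ldim N j}) = layer N j"
    and automorphic: "a > 0 \<Longrightarrow> dil N a (mul N x y) = mul N (dil N a x) (dil N a y)"


section \<open>Carnot--Caratheodory distance\<close>

text \<open>
  Horizontal curves are the absolutely continuous curves with
  \<open>\<gamma>'(t) = \<Sum>\<^sub>i c\<^sub>i(t) X\<^sub>1\<^sub>,\<^sub>i(\<gamma>(t))\<close> for almost every \<open>t \<in> [0,1]\<close>, with integrable \<open>c\<^sub>i\<close>; the
  differential equation is written in integrated form.  The length is computed with respect to the
  metric making \<open>X\<^sub>1\<^sub>,\<^sub>1, X\<^sub>1\<^sub>,\<^sub>2, \<dots>\<close> orthonormal.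
\<close>

definition horizontal_curve ::
  "'a::euclidean_space stratified \<Rightarrow> (real \<Rightarrow> 'a) \<Rightarrow> (nat \<Rightarrow> real \<Rightarrow> real) \<Rightarrow> bool" where
  "horizontal_curve N \<gamma> c \<longleftrightarrow>
     continuous_on {0..1} \<gamma> \<and>
     (\<forall>i\<in>{1..ldim N 1}. c i absolutely_integrable_on {0..1}) \<and>
     (\<forall>t\<in>{0..1}. ((\<lambda>s. \<Sum>i=1..ldim N 1. c i s *\<^sub>R left_field N (frame N 1 i) (\<gamma> s))
                     has_integral (\<gamma> t - \<gamma> 0)) {0..t})"

definition cc_dist :: "'a::euclidean_space stratified \<Rightarrow> 'a \<Rightarrow> 'a \<Rightarrow> real" where
  "cc_dist N x y =
     Inf {integral {0..1} (\<lambda>t. sqrt (\<Sum>i=1..ldim N 1. (c i t)\<^sup>2)) | \<gamma> c.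
            horizontal_curve N \<gamma> c \<and> \<gamma> 0 = x \<and> \<gamma> 1 = y}"

definition cc_ball :: "'a::euclidean_space stratified \<Rightarrow> 'a \<Rightarrow> real \<Rightarrow> 'a set" where
  "cc_ball N x r = {y. cc_dist N x y < r}"


section \<open>The semidirect product with the dilations, and its exponential map\<close>

definition G_set :: "('a::euclidean_space \<times> real) set" where
  "G_set = UNIV \<times> {0<..}"

definition gmul :: "'a::euclidean_space stratified \<Rightarrow> 'a \<times> real \<Rightarrow> 'a \<times> real \<Rightarrow> 'a \<times> real" where
  "gmul N x y = (mul N (fst x) (dil N (snd x) (fst y)), snd x * snd y)"

text \<open>Right Haar measure \<open>a\<^sup>-\<^sup>1 dn da\<close>, as a measure on \<open>'a \<times> \<real>\<close> concentrated on \<^const>\<open>G_set\<close>.\<close>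

definition right_haar :: "('a::euclidean_space \<times> real) measure" where
  "right_haar = density lborel (\<lambda>(n, a). if a > 0 then ennreal (1 / a) else 0)"

text \<open>
  The Lie algebra \<open>\<gg> = \<nn> \<oplus> \<aa>\<close> is the tangent space \<open>'a \<times> \<real>\<close> at the identity \<open>(0, 1)\<close>.  In it
  \<open>X\<^sub>0\<close> is \<open>(0, 1)\<close> and \<open>X\<^sub>j\<^sub>,\<^sub>i\<close> is \<^term>\<open>(frame N j i, 0::real)\<close>.
\<close>

definition one_param_subgroup ::
  "'a::euclidean_space stratified \<Rightarrow> 'a \<times> real \<Rightarrow> (real \<Rightarrow> 'a \<times> real) \<Rightarrow> bool" where
  "one_param_subgroup N W \<gamma> \<longleftrightarrow>
     (\<forall>t. \<gamma> t \<in> G_set) \<and> (\<forall>s t. \<gamma> (s + t) = gmul N (\<gamma> s) (\<gamma> t)) \<and>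
     (\<gamma> has_vector_derivative W) (at 0)"

definition exp_G :: "'a::euclidean_space stratified \<Rightarrow> 'a \<times> real \<Rightarrow> 'a \<times> real" where
  "exp_G N W = (THE \<gamma>. one_param_subgroup N W \<gamma>) 1"

definition n_basis :: "'a::euclidean_space stratified \<Rightarrow> 'a set" where
  "n_basis N = (\<Union>j\<in>{1..step N}. frame N j ` {1..ldim N j})"

text \<open>The scalar product on \<open>\<gg>\<close> for which \<open>X\<^sub>0\<close> and the \<open>X\<^sub>j\<^sub>,\<^sub>i\<close> are orthonormal.\<close>

definition g_inner :: "'a::euclidean_space stratified \<Rightarrow> 'a \<times> real \<Rightarrow> 'a \<times> real \<Rightarrow> real" where
  "g_inner N U W = snd U * snd W +
     (\<Sum>b\<in>n_basis N. representation (n_basis N) (fst U) b * representation (n_basis N) (fst W) b)"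

definition Z_set :: "'a::euclidean_space stratified \<Rightarrow> ('a \<times> real) set" where
  "Z_set N = {Z. g_inner N Z (0, 1) = 1}"


section \<open>Flow measures\<close>

text \<open>Values of \<open>\<phi>\<close> outside \<^const>\<open>G_set\<close> are irrelevant, as \<^const>\<open>right_haar\<close> vanishes there.\<close>

definition flow_density ::
  "'a::euclidean_space stratified \<Rightarrow> 'a \<times> real \<Rightarrow> ('a \<times> real) measure \<Rightarrow> ('a \<times> real \<Rightarrow> real) \<Rightarrow> bool"
where
  "flow_density N Z \<mu> \<phi> \<longleftrightarrow>
     \<phi> \<in> borel_measurable borel \<and> (\<forall>x\<in>G_set. \<phi> x \<ge> 0) \<and>
     (\<forall>x\<in>G_set. \<forall>t. \<phi> x = \<phi> (gmul N x (exp_G N (t *\<^sub>R Z)))) \<and>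
     \<mu> = density right_haar (\<lambda>x. ennreal (\<phi> x))"

definition flow_measure ::
  "'a::euclidean_space stratified \<Rightarrow> 'a \<times> real \<Rightarrow> ('a \<times> real) measure \<Rightarrow> bool" where
  "flow_measure N Z \<mu> \<longleftrightarrow> (\<exists>\<phi>. flow_density N Z \<mu> \<phi>)"

text \<open>The measure \<open>\<mu>\<^sub>N\<close>.  Any two flow-invariant densities of \<open>\<mu>\<close> have slices \<open>\<phi>(\<cdot>, 1)\<close> that agree
  almost everywhere, so the choice of \<open>\<phi>\<close> does not affect \<open>\<mu>\<^sub>N\<close>.\<close>

definition slice_measure ::
  "'a::euclidean_space stratified \<Rightarrow> 'a \<times> real \<Rightarrow> ('a \<times> real) measure \<Rightarrow> 'a measure" where
  "slice_measure N Z \<mu> = density lborel (\<lambda>n. ennreal ((SOME \<phi>. flow_density N Z \<mu> \<phi>) (n, 1)))"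

definition doubling :: "'a::euclidean_space stratified \<Rightarrow> 'a measure \<Rightarrow> bool" where
  "doubling N M \<longleftrightarrow>
     (\<forall>x. \<forall>r>0. 0 < emeasure M (cc_ball N x r) \<and> emeasure M (cc_ball N x r) < \<infinity>) \<and>
     (\<forall>C>1. \<exists>D>1. \<forall>x. \<forall>r>0.
        emeasure M (cc_ball N x (C * r)) \<le> ennreal D * emeasure M (cc_ball N x r))"

definition doubling_flow_measures ::
  "'a::euclidean_space stratified \<Rightarrow> 'a \<times> real \<Rightarrow> ('a \<times> real) measure set" where
  "doubling_flow_measures N Z = {\<mu>. flow_measure N Z \<mu> \<and> doubling N (slice_measure N Z \<mu>)}"


section \<open>Christ cubes and admissible cylinders\<close>

text \<open>\<^term>\<open>\<Q> k\<close> is the family of cubes of generation \<open>k\<close>, and \<^term>\<open>pN k Q\<close> is the parent (of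
  generation \<open>k - 1\<close>) of a cube \<open>Q\<close> of generation \<open>k\<close>.\<close>

definition cube_children ::
  "(int \<Rightarrow> 'a set set) \<Rightarrow> (int \<Rightarrow> 'a set \<Rightarrow> 'a set) \<Rightarrow> int \<Rightarrow> 'a set \<Rightarrow> 'a set set" where
  "cube_children \<Q> pN k Q = {Q' \<in> \<Q> (k + 1). pN (k + 1) Q' = Q}"

locale christ_cubes =
  fixes N :: "'a::euclidean_space stratified" and M :: "'a measure"
    and \<Q> :: "int \<Rightarrow> 'a set set" and pN :: "int \<Rightarrow> 'a set \<Rightarrow> 'a set"
    and \<delta> C\<^sub>1 c :: real
  assumes delta: "0 < \<delta>" "\<delta> < 1" and C1: "C\<^sub>1 \<ge> 3" and c: "c > 0"
    and countable: "countable (\<Q> k)"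
    and disjoint: "disjoint (\<Q> k)"
    and "open": "Q \<in> \<Q> k \<Longrightarrow> open Q"
    and covering: "emeasure M (UNIV - \<Union>(\<Q> k)) = 0"
    and parent: "Q \<in> \<Q> k \<Longrightarrow> pN k Q \<in> \<Q> (k - 1) \<and> Q \<subseteq> pN k Q"
    and parent_disjoint: "\<lbrakk>Q \<in> \<Q> k; R \<in> \<Q> (k - 1); R \<noteq> pN k Q\<rbrakk> \<Longrightarrow> Q \<inter> R = {}"
    and balls: "Q \<in> \<Q> k \<Longrightarrow>
          \<exists>n\<in>Q. cc_ball N n (c * \<delta> powi k) \<subseteq> Q \<and> Q \<subseteq> cc_ball N n (C\<^sub>1 * \<delta> powi k)"
    and parent_measure: "Q \<in> \<Q> k \<Longrightarrow> emeasure M (pN k Q) \<le> ennreal C\<^sub>1 * emeasure M Q"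
    and children_finite: "Q \<in> \<Q> k \<Longrightarrow> finite (cube_children \<Q> pN k Q)"
    and children_le: "Q \<in> \<Q> k \<Longrightarrow> real (card (cube_children \<Q> pN k Q)) \<le> C\<^sub>1"
    and children_ge_2: "Q \<in> \<Q> k \<Longrightarrow> 2 \<le> card (cube_children \<Q> pN k Q)"

definition cylinder ::
  "'a::euclidean_space stratified \<Rightarrow> 'a \<times> real \<Rightarrow> real \<Rightarrow> 'a set \<Rightarrow> real \<Rightarrow> ('a \<times> real) set" where
  "cylinder N Z r E a =
     {gmul N (n, 1) (exp_G N (t *\<^sub>R Z)) | n t. n \<in> E \<and> t \<in> {ln (a / r)<..<ln (a * r)}}"

definition large_params :: "real \<Rightarrow> real \<Rightarrow> real \<Rightarrow> int \<Rightarrow> real \<Rightarrow> real \<Rightarrow> bool" where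
  "large_params \<delta> \<gamma> lam k r a \<longleftrightarrow>
     r > exp 1 \<and> a * r\<^sup>2 \<le> \<delta> powi k \<and> \<delta> powi k \<le> lam * a * r powr \<gamma>"

definition small_params :: "real \<Rightarrow> real \<Rightarrow> int \<Rightarrow> real \<Rightarrow> real \<Rightarrow> bool" where
  "small_params \<delta> lam k r a \<longleftrightarrow>
     1 < r \<and> r \<le> exp 1 \<and> a * (exp 1)\<^sup>2 * ln r \<le> \<delta> powi k \<and> \<delta> powi k \<le> lam * a * (exp 1)\<^sup>2 * ln r"

definition admissible_cylinders ::
  "'a::euclidean_space stratified \<Rightarrow> 'a \<times> real \<Rightarrow> (int \<Rightarrow> 'a set set) \<Rightarrow> real \<Rightarrow> real \<Rightarrow> real
     \<Rightarrow> ('a \<times> real) set set" where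
  "admissible_cylinders N Z \<Q> \<delta> \<gamma> lam =
     {cylinder N Z r Q a | r Q a k. Q \<in> \<Q> k \<and> r > 1 \<and> a > 0 \<and>
        (large_params \<delta> \<gamma> lam k r a \<or> small_params \<delta> lam k r a)}"

end

theory Submission
  imports Defs
begin

text \<open>
  Since the group law is smooth and homogeneous under the dilations, it is triangular with respect to
  the layers.  Hence Lebesgue measure is invariant under right translations, and every \<open>Z\<close> with
  \<open>X\<^sub>0\<close>-component \<open>1\<close> is conjugate to \<open>X\<^sub>0\<close> by an element of \<open>N\<close>, so that \<open>exp(tZ)\<close> is explicit.  In
  the coordinates \<open>(n, t) \<mapsto> (n, 1) exp(tZ)\<close> the flow measure becomes the product of \<open>\<mu>\<^sub>N\<close> and Lebesgue
  measure, and a cylinder becomes a box \<open>Q \<times> I\<close>.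

  Let \<open>I\<close> run through the dyadic intervals, write \<open>2\<^sup>j\<close> for the half-length of \<open>I\<close>, let \<open>G(I)\<close> be the
  largest generation whose cubes satisfy the lower admissibility bound over \<open>I\<close>, and let \<open>I'\<close> be the
  dyadic parent of \<open>I\<close>.  The family \<open>\<D>\<^sub>k\<close> consists of all \<open>Q \<times> I\<close> with \<open>Q\<close> of generation \<open>k + j\<close> and
  \<open>G(I') \<le> k + j \<le> G(I)\<close>; the left inequality gives the upper admissibility bound.  Over a fixed \<open>t\<close>
  these ranges of \<open>k\<close> tile the integers, so that \<open>\<D>\<^sub>k\<close> is a partition, and passing from \<open>k\<close> to \<open>k + 1\<close>
  either divides \<open>Q\<close> into its children or halves \<open>I\<close>.  Both decrease the measure at least by the factor
  \<open>1 - 1/C\<^sub>1\<close>, whence the limits.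
\<close>

section \<open>Layers and dilations\<close>

context stratified_group
begin

definition proj :: "nat \<Rightarrow> 'a \<Rightarrow> 'a" where
  "proj j x = (THE y. layer_decomp N x y) j"

lemma layer_decomp_proj: "layer_decomp N x (\<lambda>j. proj j x)"
  unfolding proj_def using theI'[OF direct_sum[of x]] .

lemma proj_eqI: "layer_decomp N x y \<Longrightarrow> proj j x = y j"
  unfolding proj_def using the1_equality[OF direct_sum] by metis

lemma proj_in_layer: "j \<in> {1..step N} \<Longrightarrow> proj j x \<in> layer N j"
  using layer_decomp_proj[of x] unfolding layer_decomp_def by (auto split: if_splits)

lemma proj_outside: "j \<notin> {1..step N} \<Longrightarrow> proj j x = 0"
  using layer_decomp_proj[of x] unfolding layer_decomp_def by (metis (full_types))

lemma sum_proj: "(\<Sum>j=1..step N. proj j x) = x"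
  using layer_decomp_proj[of x] unfolding layer_decomp_def by simp

lemma linear_proj: "linear (proj j)"
proof (rule linearI)
  fix x y :: 'a
  have "layer_decomp N (x + y) (\<lambda>j. proj j x + proj j y)"
    unfolding layer_decomp_def
    using proj_in_layer proj_outside layer_subspace
    by (auto simp: sum.distrib sum_proj[simplified] subspace_add)
  from proj_eqI[OF this] show "proj j (x + y) = proj j x + proj j y" .
next
  fix r :: real and x :: 'a
  have "layer_decomp N (r *\<^sub>R x) (\<lambda>j. r *\<^sub>R proj j x)"
    unfolding layer_decomp_def
    using proj_in_layer proj_outside layer_subspace
    by (auto simp: scaleR_right.sum[symmetric] sum_proj[simplified] subspace_scale)
  from proj_eqI[OF this] show "proj j (r *\<^sub>R x) = r *\<^sub>R proj j x" .
qed

lemmas proj_add = linear_add[OF linear_proj]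
  and proj_diff = linear_diff[OF linear_proj]
  and proj_scaleR = linear_cmul[OF linear_proj]
  and proj_minus = linear_neg[OF linear_proj]
  and proj_0 = linear_0[OF linear_proj]
  and proj_sum = linear_sum[OF linear_proj]

lemma bounded_linear_proj: "bounded_linear (proj j)"
  using linear_proj linear_conv_bounded_linear by blast

lemma proj_layer:
  assumes "v \<in> layer N i" "i \<in> {1..step N}"
  shows "proj j v = (if j = i then v else 0)"
proof -
  have "layer_decomp N v (\<lambda>j. if j = i then v else 0)"
    unfolding layer_decomp_def
    using assms layer_subspace[THEN subspace_0] by auto
  from proj_eqI[OF this] show ?thesis .
qed

lemma proj_proj: "proj j (proj i x) = (if j = i then proj i x else 0)"
proof (cases "i \<in> {1..step N}")
  case True
  with proj_layer[OF proj_in_layer] show ?thesis by simp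
qed (simp add: proj_outside proj_0)

lemma proj_cong:
  assumes "\<And>j. j \<in> {1..step N} \<Longrightarrow> proj j x = proj j y"
  shows "x = y"
  using sum_proj[of x] sum_proj[of y] assms by (metis (no_types, lifting) sum.cong)

lemma dil_eq: "dil N a x = (\<Sum>j=1..step N. a ^ j *\<^sub>R proj j x)"
  unfolding dil_def proj_def ..

lemma proj_dil: "proj j (dil N a x) = a ^ j *\<^sub>R proj j x"
proof (cases "j \<in> {1..step N}")
  case True
  then show ?thesis
    by (simp add: dil_eq proj_sum proj_scaleR proj_proj if_distrib[of "scaleR _"] sum.delta cong: if_cong)
qed (simp add: proj_outside)

lemma linear_dil: "linear (dil N a)"
  by (rule linearI; rule proj_cong) (simp_all add: proj_dil proj_add proj_scaleR algebra_simps)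

lemma dil_1 [simp]: "dil N 1 x = x"
  by (rule proj_cong) (simp add: proj_dil)

lemma dil_dil: "dil N a (dil N b x) = dil N (a * b) x"
  by (rule proj_cong) (simp add: proj_dil power_mult_distrib)

lemmas dil_0_right [simp] = linear_0[OF linear_dil]
  and dil_minus = linear_neg[OF linear_dil]

lemma continuous_dil: "continuous_on UNIV (\<lambda>p. dil N (fst p) (snd p))"
  unfolding dil_eq
  by (intro continuous_intros bounded_linear.continuous_on[OF bounded_linear_proj])

lemma dil_has_derivative:
  assumes "(\<alpha> has_real_derivative \<alpha>') (at t)"
  shows "((\<lambda>t. dil N (\<alpha> t) x) has_vector_derivative
    (\<Sum>j=1..step N. (real j * \<alpha> t ^ (j - 1) * \<alpha>') *\<^sub>R proj j x)) (at t)"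
  unfolding dil_eq using assms
  by (auto intro!: derivative_eq_intros simp: algebra_simps)


section \<open>Triangularity of the group law\<close>

lemma mul_assoc: "mul N (mul N x y) z = mul N x (mul N y z)"
  and mul_0_left [simp]: "mul N 0 x = x"
  and mul_minus_left [simp]: "mul N (- x) x = 0"
proof -
  interpret group "mul N" 0 uminus by (rule group)
  show "mul N (mul N x y) z = mul N x (mul N y z)" "mul N 0 x = x" "mul N (- x) x = 0"
    by (auto simp: assoc)
qed

lemma mul_minus_right [simp]: "mul N x (- x) = 0"
  using mul_minus_left[of "- x"] by simp

lemma mul_0_right [simp]: "mul N x 0 = x"
  by (metis mul_0_left mul_assoc mul_minus_left mul_minus_right)

lemma mul_minus_cancel [simp]:
  "mul N (- x) (mul N x y) = y" "mul N x (mul N (- x) y) = y"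
  "mul N (mul N y x) (- x) = y" "mul N (mul N y (- x)) x = y"
  by (simp_all flip: mul_assoc) (simp_all add: mul_assoc)

definition mul_deriv :: "'a \<times> 'a \<Rightarrow> 'a \<times> 'a \<Rightarrow> 'a" where
  "mul_deriv p = frechet_derivative (\<lambda>(x, y). mul N x y) (at p)"

lemma mul_has_derivative: "((\<lambda>(x, y). mul N x y) has_derivative mul_deriv p) (at p)"
proof -
  have "Ck_map 1 (\<lambda>(x, y). mul N x y)"
    using smooth unfolding smooth_map_def by blast
  then have "(\<lambda>(x, y). mul N x y) differentiable (at p)"
    unfolding One_nat_def Ck_map.simps by blast
  then show ?thesis
    unfolding mul_deriv_def by (simp add: frechet_derivative_works[symmetric])
qed

lemma continuous_mul_deriv: "continuous_on UNIV (\<lambda>p. mul_deriv p v)"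
proof -
  have "Ck_map 1 (\<lambda>(x, y). mul N x y)"
    using smooth unfolding smooth_map_def by blast
  then show ?thesis
    unfolding mul_deriv_def One_nat_def Ck_map.simps by blast
qed

lemmas linear_mul_deriv = has_derivative_linear[OF mul_has_derivative]

lemma mul_has_vector_derivative:
  assumes "(f has_vector_derivative f') (at t)" "(g has_vector_derivative g') (at t)"
  shows "((\<lambda>t. mul N (f t) (g t)) has_vector_derivative mul_deriv (f t, g t) (f', g')) (at t)"
proof -
  have "((\<lambda>t. (f t, g t)) has_vector_derivative (f', g')) (at t)"
    using assms by (rule has_vector_derivative_Pair)
  from vector_derivative_diff_chain_within[OF this, of "\<lambda>(x, y). mul N x y"]
  show ?thesis
    using has_derivative_at_withinI[OF mul_has_derivative[of "(f t, g t)"]]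
    by (simp add: o_def)
qed

lemma continuous_mul: "continuous_on UNIV (\<lambda>p. mul N (fst p) (snd p))"
  using mul_has_derivative has_derivative_continuous
  by (fastforce simp: continuous_on_eq_continuous_at case_prod_unfold)

lemma continuous_on_mul [continuous_intros]:
  assumes "continuous_on S f" "continuous_on S g"
  shows "continuous_on S (\<lambda>x. mul N (f x) (g x))"
  using continuous_on_compose2[OF continuous_mul continuous_on_Pair[OF assms]] by simp

lemma continuous_on_dil [continuous_intros]:
  assumes "continuous_on S f" "continuous_on S g"
  shows "continuous_on S (\<lambda>x. dil N (f x) (g x))"
  using continuous_on_compose2[OF continuous_dil continuous_on_Pair[OF assms]] by simp

text \<open>Multiplication by the identity on either side fixes a curve, so both partial derivatives
  at the identity are the identity map; linearity adds them.\<close>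

lemma mul_deriv_0: "mul_deriv (0, 0) (u, w) = u + w"
proof -
  have id: "((\<lambda>t. t *\<^sub>R v) has_vector_derivative v) (at 0)" for v :: 'a
    by (auto intro!: derivative_eq_intros)
  have "((\<lambda>t. t *\<^sub>R u) has_vector_derivative mul_deriv (0, 0) (u, 0)) (at 0)"
    using mul_has_vector_derivative[OF id has_vector_derivative_const[of 0]] by simp
  then have 1: "mul_deriv (0, 0) (u, 0) = u"
    using id vector_derivative_unique_at by blast
  have "((\<lambda>t. t *\<^sub>R w) has_vector_derivative mul_deriv (0, 0) (0, w)) (at 0)"
    using mul_has_vector_derivative[OF has_vector_derivative_const[of 0] id] by simp
  then have 2: "mul_deriv (0, 0) (0, w) = w"
    using id vector_derivative_unique_at by blast
  show ?thesis
    using linear_add[OF linear_mul_deriv, of "(0, 0)" "(u, 0)" "(0, w)"] 1 2 by simp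
qed

text \<open>The automorphism property of the dilations is differentiated along the line through
  \<open>(x, y)\<close> with direction \<open>(u, w)\<close>.\<close>

lemma mul_deriv_dil:
  assumes "a > 0"
  shows "mul_deriv (dil N a x, dil N a y) (dil N a u, dil N a w) = dil N a (mul_deriv (x, y) (u, w))"
proof -
  have id: "((\<lambda>t. p + t *\<^sub>R v) has_vector_derivative v) (at 0)" for p v :: 'a
    by (auto intro!: derivative_eq_intros)
  have bl: "bounded_linear (dil N a)"
    using linear_dil linear_conv_bounded_linear by blast
  have "((\<lambda>t. dil N a (mul N (x + t *\<^sub>R u) (y + t *\<^sub>R w))) has_vector_derivative
      dil N a (mul_deriv (x, y) (u, w))) (at 0)"
    using bounded_linear.has_vector_derivative[OF bl mul_has_vector_derivative[OF id id]] by simp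
  moreover have "dil N a (mul N (x + t *\<^sub>R u) (y + t *\<^sub>R w)) =
      mul N (dil N a x + t *\<^sub>R dil N a u) (dil N a y + t *\<^sub>R dil N a w)" for t
    using assms by (simp add: automorphic linear_add[OF linear_dil] linear_cmul[OF linear_dil])
  moreover have "((\<lambda>t. mul N (dil N a x + t *\<^sub>R dil N a u) (dil N a y + t *\<^sub>R dil N a w))
      has_vector_derivative mul_deriv (dil N a x, dil N a y) (dil N a u, dil N a w)) (at 0)"
    using mul_has_vector_derivative[OF id id, of "dil N a x"] by simp
  ultimately show ?thesis
    using vector_derivative_unique_at by force
qed

text \<open>The derivative scales by \<open>a\<^sup>j\<^sup>-\<^sup>i\<close> under the dilation by \<open>a\<close>; let \<open>a \<rightarrow> 0\<close> and use its
  continuity at the identity.\<close>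

lemma proj_mul_deriv_layer:
  assumes "i \<in> {1..step N}" "j \<le> i" "u \<in> layer N i" "w \<in> layer N i"
  shows "proj j (mul_deriv (x, y) (u, w)) = proj j (u + w)"
proof -
  define c where "c a = proj j (mul_deriv (dil N a x, dil N a y) (u, w))" for a
  have eq: "a ^ (i - j) *\<^sub>R c a = c 1" if a: "a > 0" for a
  proof -
    have layer: "dil N a v = a ^ i *\<^sub>R v" if "v \<in> layer N i" for v
      by (rule proj_cong) (simp add: proj_dil proj_layer[OF that assms(1)] proj_scaleR)
    have "a ^ i *\<^sub>R c a = a ^ j *\<^sub>R c 1"
      using arg_cong[OF mul_deriv_dil[OF a, of x y u w], of "proj j"] assms
        linear_cmul[OF linear_mul_deriv, of "(dil N a x, dil N a y)" "a ^ i" "(u, w)"]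
      by (simp add: layer proj_dil c_def proj_scaleR)
    then have "a ^ j *\<^sub>R (a ^ (i - j) *\<^sub>R c a) = a ^ j *\<^sub>R c 1"
      using assms(2) by (simp flip: power_add)
    then show ?thesis using a by (simp only: scaleR_cancel_left) simp
  qed
  have "isCont c 0"
  proof -
    have "continuous_on UNIV c"
      unfolding c_def
      by (intro continuous_intros bounded_linear.continuous_on[OF bounded_linear_proj]
          continuous_on_compose2[OF continuous_mul_deriv]) auto
    then show ?thesis by (simp add: continuous_on_eq_continuous_at)
  qed
  then have "((\<lambda>a. a ^ (i - j) *\<^sub>R c a) \<longlongrightarrow> 0 ^ (i - j) *\<^sub>R c 0) (at 0)"
    by (intro tendsto_intros) (simp add: isCont_def)
  then have "((\<lambda>a. a ^ (i - j) *\<^sub>R c a) \<longlongrightarrow> 0 ^ (i - j) *\<^sub>R c 0) (at_right 0)"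
    by (rule filterlim_mono) (auto simp: at_le)
  moreover have "((\<lambda>a. a ^ (i - j) *\<^sub>R c a) \<longlongrightarrow> c 1) (at_right 0)"
    by (rule tendsto_eventually) (auto simp: eventually_at_right_field eq intro: exI[of _ 1])
  ultimately have "c 1 = 0 ^ (i - j) *\<^sub>R c 0"
    using tendsto_unique trivial_limit_at_right_real by blast
  moreover have "dil N 0 z = 0" for z
    by (rule proj_cong) (auto simp: proj_dil proj_0)
  ultimately have "c 1 = 0 ^ (i - j) *\<^sub>R proj j (u + w)"
    by (simp add: c_def mul_deriv_0)
  \<comment> \<open>For \<open>i = j\<close> the factor is \<open>0 ^ 0 = 1\<close>; for
    \<open>j < i\<close> both sides vanish, because \<open>u + w\<close> lies in layer
    \<open>i\<close>.\<close>
  also have "\<dots> = proj j (u + w)"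
    using assms by (cases "i = j") (auto simp: proj_layer proj_add)
  finally show ?thesis by (simp add: c_def)
qed

text \<open>Split the increments into layers: those below \<open>j\<close> vanish by assumption, and
  the others are covered by \<open>proj_mul_deriv_layer\<close>.\<close>

lemma proj_mul_deriv:
  assumes "\<And>i. i < j \<Longrightarrow> proj i u = 0" "\<And>i. i < j \<Longrightarrow> proj i w = 0"
  shows "proj j (mul_deriv (x, y) (u, w)) = proj j (u + w)"
proof -
  have "(u, w) = (\<Sum>i=1..step N. (proj i u, proj i w))"
    by (simp add: sum_prod sum_proj[simplified])
  then have "proj j (mul_deriv (x, y) (u, w)) =
      (\<Sum>i=1..step N. proj j (mul_deriv (x, y) (proj i u, proj i w)))"
    by (simp add: linear_sum[OF linear_mul_deriv] proj_sum)
  also have "\<dots> = (\<Sum>i=1..step N. proj j (proj i u + proj i w))"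
  proof (rule sum.cong[OF refl])
    fix i assume i: "i \<in> {1..step N}"
    show "proj j (mul_deriv (x, y) (proj i u, proj i w)) = proj j (proj i u + proj i w)"
    proof (cases "j \<le> i")
      case True
      then show ?thesis using proj_mul_deriv_layer[OF i True] i by (simp add: proj_in_layer)
    next
      case False
      then show ?thesis using assms linear_0[OF linear_mul_deriv]
        by (simp add: proj_0 zero_prod_def[symmetric])
    qed
  qed
  also have "\<dots> = proj j (u + w)"
    by (simp add: proj_sum[symmetric] sum.distrib sum_proj[simplified])
  finally show ?thesis .
qed

text \<open>Join the two pairs by a segment. Its direction has no components below \<open>j\<close>,
  so \<open>proj_mul_deriv\<close> makes the derivative of \<open>h\<close> zero. Thus the nonlinear
  part of the \<open>j\<close>-th component of a product involves only lower components.\<close>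

lemma mul_triangular:
  assumes "\<And>i. i < j \<Longrightarrow> proj i x = proj i x'" "\<And>i. i < j \<Longrightarrow> proj i y = proj i y'"
  shows "proj j (mul N x y) - proj j x - proj j y = proj j (mul N x' y') - proj j x' - proj j y'"
proof -
  define u w where "u = x' - x" and "w = y' - y"
  define h where "h t = proj j (mul N (x + t *\<^sub>R u) (y + t *\<^sub>R w)) - t *\<^sub>R proj j (u + w)" for t
  have line: "((\<lambda>t. p + t *\<^sub>R v) has_vector_derivative v) (at t within UNIV)" for p v :: 'a and t
    by (auto intro!: derivative_eq_intros)
  have "(h has_vector_derivative
      proj j (mul_deriv (x + t *\<^sub>R u, y + t *\<^sub>R w) (u, w)) - proj j (u + w)) (at t within UNIV)" for t
    unfolding h_def
    by (intro has_vector_derivative_diff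
        bounded_linear.has_vector_derivative[OF bounded_linear_proj]
        mul_has_vector_derivative line) (auto intro!: derivative_eq_intros)
  then have "(h has_vector_derivative 0) (at t within UNIV)" for t
    using assms by (simp add: proj_mul_deriv u_def w_def proj_diff)
  then obtain c where "\<And>t. h t = c"
    using has_vector_derivative_zero_constant[of UNIV h] by auto
  then have "h 0 = h 1" by simp
  then show ?thesis
    by (simp add: h_def u_def w_def proj_add proj_diff algebra_simps)
qed

end


section \<open>Invariance of Lebesgue measure under right translations\<close>

lemma nn_integral_lborel_shift:
  fixes g :: "'a::euclidean_space \<Rightarrow> ennreal"
  assumes [measurable]: "g \<in> borel_measurable borel"
  shows "(\<integral>\<^sup>+x. g (x + a) \<partial>lborel) = (\<integral>\<^sup>+x. g x \<partial>lborel)"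
proof -
  have "(\<integral>\<^sup>+x. g x \<partial>lborel) = (\<integral>\<^sup>+x. g x \<partial>distr lborel borel ((+) a))"
    by (simp add: lborel_distr_plus)
  also have "\<dots> = (\<integral>\<^sup>+x. g (x + a) \<partial>lborel)"
    by (subst nn_integral_distr) (auto simp: add.commute)
  finally show ?thesis by simp
qed

text \<open>Averaging with the weight \<open>h\<close> over the translations by \<open>\<pi> u\<close> turns the shear into a
  translation of \<open>u\<close>, so no coordinates adapted to the range of \<open>\<pi>\<close> are needed.\<close>

lemma nn_integral_lborel_shear:
  fixes f \<pi> :: "'a::euclidean_space \<Rightarrow> 'a"
  assumes lin: "linear \<pi>" and f: "f \<in> borel_measurable borel"
    and range: "\<And>x. \<pi> (f x) = f x" and inv: "\<And>x u. f (x + \<pi> u) = f x"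
    and g: "g \<in> borel_measurable borel"
  shows "(\<integral>\<^sup>+x. g (x + f x) \<partial>lborel) = (\<integral>\<^sup>+x. g x \<partial>lborel)"
proof -
  note [measurable] = f g
  have [measurable]: "\<pi> \<in> borel_measurable borel"
    using lin by (intro borel_measurable_continuous_onI linear_continuous_on)
      (simp add: linear_conv_bounded_linear)
  define h :: "'a \<Rightarrow> ennreal" where "h = indicator (box 0 One)"
  have [measurable]: "h \<in> borel_measurable borel" by (simp add: h_def)
  have h: "(\<integral>\<^sup>+u. h u \<partial>lborel) = 1" by (simp add: h_def)
  have "(\<integral>\<^sup>+x. g (x + f x) \<partial>lborel) = (\<integral>\<^sup>+u. h u * (\<integral>\<^sup>+x. g (x + f x) \<partial>lborel) \<partial>lborel)"
    by (simp add: nn_integral_multc h)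
  also have "\<dots> = (\<integral>\<^sup>+u. h u * (\<integral>\<^sup>+x. g (x + \<pi> u + f (x + \<pi> u)) \<partial>lborel) \<partial>lborel)"
    using nn_integral_lborel_shift[of "\<lambda>x. g (x + f x)"] by simp
  also have "\<dots> = (\<integral>\<^sup>+u. (\<integral>\<^sup>+x. h u * g (x + \<pi> (u + f x)) \<partial>lborel) \<partial>lborel)"
    by (simp add: nn_integral_cmult inv linear_add[OF lin] range add.assoc)
  also have "\<dots> = (\<integral>\<^sup>+x. (\<integral>\<^sup>+u. h u * g (x + \<pi> (u + f x)) \<partial>lborel) \<partial>lborel)"
    by (rule lborel_pair.Fubini') simp
  also have "\<dots> = (\<integral>\<^sup>+x. (\<integral>\<^sup>+u. h (u - f x) * g (x + \<pi> u) \<partial>lborel) \<partial>lborel)"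
  proof (rule nn_integral_cong)
    fix x
    show "(\<integral>\<^sup>+u. h u * g (x + \<pi> (u + f x)) \<partial>lborel) = (\<integral>\<^sup>+u. h (u - f x) * g (x + \<pi> u) \<partial>lborel)"
      using nn_integral_lborel_shift[of "\<lambda>u. h (u - f x) * g (x + \<pi> u)" "f x"] by simp
  qed
  also have "\<dots> = (\<integral>\<^sup>+u. (\<integral>\<^sup>+x. h (u - f x) * g (x + \<pi> u) \<partial>lborel) \<partial>lborel)"
    by (rule lborel_pair.Fubini') simp
  \<comment> \<open>At fixed \<open>u\<close> the variable \<open>x\<close> is translated by
    \<open>\<pi> u\<close>; by \<open>inv\<close> this leaves the weight \<open>h (u - f x)\<close>
    unchanged.\<close>
  also have "\<dots> = (\<integral>\<^sup>+u. (\<integral>\<^sup>+x. h (u - f x) * g x \<partial>lborel) \<partial>lborel)"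
  proof (rule nn_integral_cong)
    fix u
    show "(\<integral>\<^sup>+x. h (u - f x) * g (x + \<pi> u) \<partial>lborel) = (\<integral>\<^sup>+x. h (u - f x) * g x \<partial>lborel)"
      using nn_integral_lborel_shift[of "\<lambda>x. h (u - f x) * g x" "\<pi> u"] by (simp add: inv)
  qed
  also have "\<dots> = (\<integral>\<^sup>+x. (\<integral>\<^sup>+u. h (u - f x) * g x \<partial>lborel) \<partial>lborel)"
    by (rule lborel_pair.Fubini') simp
  also have "\<dots> = (\<integral>\<^sup>+x. g x \<partial>lborel)"
  proof (rule nn_integral_cong)
    fix x
    show "(\<integral>\<^sup>+u. h (u - f x) * g x \<partial>lborel) = g x"
      using nn_integral_lborel_shift[of h "- f x"] h by (simp add: nn_integral_multc)
  qed
  finally show ?thesis .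
qed

context stratified_group
begin

text \<open>In layer \<open>j\<close>, right multiplication by \<open>b\<close> adds
  \<open>F j x\<close>, which depends only on the layers below \<open>j\<close>. It is therefore the
  composition of one shear per layer: \<open>T (Suc m)\<close> first shifts layer
  \<open>Suc m\<close>, which \<open>T m\<close> does not look at, and then applies
  \<open>T m\<close>.\<close>

lemma nn_integral_right_mul:
  assumes "g \<in> borel_measurable borel"
  shows "(\<integral>\<^sup>+x. g (mul N x b) \<partial>lborel) = (\<integral>\<^sup>+x. g x \<partial>lborel)"
proof -
  define F where "F j x = proj j (mul N x b) - proj j x" for j x
  define T where "T m x = x + (\<Sum>j=1..m. F j x)" for m :: nat and x
  have F_cong: "F j x = F j y" if "\<And>i. i < j \<Longrightarrow> proj i x = proj i y" for j x y
    using mul_triangular[of j x y b b] that by (simp add: F_def)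
  have F_cont: "continuous_on UNIV (F j)" for j
    unfolding F_def
    by (intro continuous_intros bounded_linear.continuous_on[OF bounded_linear_proj])
  then have F_meas: "F j \<in> borel_measurable borel" for j
    by (rule borel_measurable_continuous_onI)
  have T_meas: "T m \<in> borel_measurable borel" for m
    unfolding T_def using F_cont by (intro borel_measurable_continuous_onI continuous_intros) auto
  have F_shift: "F i (x + proj j u) = F i x" if "i \<le> j" for i j x u
    using that by (intro F_cong) (simp add: proj_add proj_proj)
  have proj_F: "proj j (F j x) = F j x" for j x
    by (simp add: F_def proj_diff proj_proj)
  have T_Suc: "T (Suc m) x = T m (x + F (Suc m) x)" for m x
    using F_shift[of _ "Suc m" x "F (Suc m) x"] by (simp add: T_def proj_F)
  have "(\<integral>\<^sup>+x. g (T m x) \<partial>lborel) = (\<integral>\<^sup>+x. g x \<partial>lborel)" for m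
  proof (induction m)
    case 0
    then show ?case by (simp add: T_def)
  next
    case (Suc m)
    have "(\<integral>\<^sup>+x. g (T (Suc m) x) \<partial>lborel) = (\<integral>\<^sup>+x. g (T m x) \<partial>lborel)"
      unfolding T_Suc
      by (rule nn_integral_lborel_shear[where g = "\<lambda>x. g (T m x)", OF linear_proj F_meas proj_F F_shift])
        (use assms T_meas in \<open>auto intro: measurable_compose\<close>)
    with Suc show ?case by simp
  qed
  from this[of "step N"] show ?thesis
    using sum_proj by (simp add: T_def F_def sum_subtractf)
qed


section \<open>One-parameter subgroups\<close>

text \<open>For \<open>a = e\<^sup>t\<close> this is the \<open>N\<close>-component of the conjugate \<open>(n, 1) (0, e\<^sup>t) (n, 1)\<^sup>-\<^sup>1\<close>.\<close>

definition orbit :: "'a \<Rightarrow> real \<Rightarrow> 'a" where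
  "orbit n a = mul N n (dil N a (- n))"

text \<open>The vector \<open>(velocity n, 1)\<close> is the image of \<open>X_0\<close> under the
  adjoint action of \<open>(n, 1)\<close>.\<close>

definition velocity :: "'a \<Rightarrow> 'a" where
  "velocity n = vector_derivative (\<lambda>t. orbit n (exp t)) (at 0)"

lemma orbit_mult:
  assumes "a > 0" "b > 0"
  shows "orbit n (a * b) = mul N (orbit n a) (dil N a (orbit n b))"
  using assms by (simp add: orbit_def automorphic dil_dil mul_assoc dil_minus)

lemma continuous_on_orbit [continuous_intros]:
  "continuous_on S f \<Longrightarrow> continuous_on S (\<lambda>x. orbit n (f x))"
  unfolding orbit_def by (intro continuous_intros)

lemma orbit_has_vector_derivative:
  "((\<lambda>t. orbit n (exp t)) has_vector_derivative velocity n) (at 0)"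
  unfolding velocity_def vector_derivative_works[symmetric] orbit_def
  using mul_has_vector_derivative[OF has_vector_derivative_const dil_has_derivative[OF DERIV_exp]]
  by (rule differentiableI_vector)

text \<open>Apply \<open>mul_triangular\<close> to the product defining \<open>orbit\<close>, whose
  linear part in layer \<open>j\<close> is \<open>(1 - exp t ^ j) *\<^sub>R proj j x\<close>, and
  differentiate at \<open>t = 0\<close>.\<close>

lemma velocity_triangular:
  assumes "\<And>i. i < j \<Longrightarrow> proj i x = proj i y"
  shows "proj j (velocity x) + real j *\<^sub>R proj j x = proj j (velocity y) + real j *\<^sub>R proj j y"
proof -
  define h where "h x t = proj j (orbit x (exp t)) + exp t ^ j *\<^sub>R proj j x - proj j x" for x t
  have h: "(h x has_vector_derivative proj j (velocity x) + real j *\<^sub>R proj j x) (at 0)" for x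
  proof -
    have "((\<lambda>t. exp t ^ j) has_real_derivative real j) (at (0 :: real))"
      by (auto intro!: derivative_eq_intros)
    from has_vector_derivative_scaleR[OF this has_vector_derivative_const[of "proj j x"]]
    have "((\<lambda>t. exp t ^ j *\<^sub>R proj j x) has_vector_derivative real j *\<^sub>R proj j x) (at 0)"
      by simp
    from has_vector_derivative_diff[OF has_vector_derivative_add[OF
          bounded_linear.has_vector_derivative[OF bounded_linear_proj orbit_has_vector_derivative] this]
        has_vector_derivative_const[of "proj j x"]]
    show ?thesis unfolding h_def by simp
  qed
  have "h x t = h y t" for t
    using mul_triangular[of j x y "dil N (exp t) (- x)" "dil N (exp t) (- y)"] assms
    by (simp add: h_def orbit_def proj_dil proj_minus algebra_simps)
  then have "h x = h y" by blast
  then show ?thesis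
    using vector_derivative_unique_at h by metis
qed

text \<open>The equation is solved one layer at a time, from the bottom: by
  \<open>velocity_triangular\<close>, altering \<open>x\<close> in layer \<open>j\<close> leaves the
  velocity below \<open>j\<close> as it is and changes it in layer \<open>j\<close> by
  \<open>- j\<close> times the alteration.\<close>

lemma surj_velocity: "\<exists>x. velocity x = z"
proof -
  have "\<exists>x. \<forall>j\<in>{1..m}. proj j (velocity x) = proj j z" for m
  proof (induction m)
    case (Suc m)
    then obtain x where x: "\<And>j. j \<in> {1..m} \<Longrightarrow> proj j (velocity x) = proj j z" by blast
    define d where "d = (1 / real (Suc m)) *\<^sub>R proj (Suc m) (velocity x - z)"
    have agree: "proj i (x + d) = proj i x" if "i \<noteq> Suc m" for i
      using that by (simp add: d_def proj_add proj_scaleR proj_proj)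
    have "proj j (velocity (x + d)) = proj j z" if "j \<in> {1..Suc m}" for j
    proof (cases "j = Suc m")
      case True
      have "proj j (velocity (x + d)) + real j *\<^sub>R proj j (x + d) =
          proj j (velocity x) + real j *\<^sub>R proj j x"
        using True by (intro velocity_triangular agree) simp
      moreover have "real j *\<^sub>R proj j d = proj j (velocity x) - proj j z"
        by (simp add: d_def True proj_scaleR proj_proj proj_diff)
      ultimately show ?thesis
        by (simp add: proj_add scaleR_add_right)
    next
      case False
      have "proj j (velocity (x + d)) + real j *\<^sub>R proj j (x + d) =
          proj j (velocity x) + real j *\<^sub>R proj j x"
        using False that by (intro velocity_triangular agree) simp
      with False that x[of j] show ?thesis by (simp add: agree)
    qed
    then show ?case by blast
  qed simp
  then obtain x where "\<forall>j\<in>{1..step N}. proj j (velocity x) = proj j z" by blast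
  then have "velocity x = z" using proj_cong by blast
  then show ?thesis ..
qed

text \<open>The speed \<open>s\<close> appears because \<open>exp_G\<close> takes the value at time
  1 of the subgroup with velocity \<open>s *\<^sub>R Z\<close>.\<close>

lemma one_param_subgroup_orbit:
  "one_param_subgroup N (s *\<^sub>R (velocity n, 1)) (\<lambda>t. (orbit n (exp (s * t)), exp (s * t)))"
  unfolding one_param_subgroup_def
proof (intro conjI allI)
  have "((\<lambda>t. orbit n (exp t)) has_vector_derivative velocity n) (at (s * 0))"
    using orbit_has_vector_derivative by simp
  moreover have "((*) s has_vector_derivative s) (at 0)"
    by (auto intro!: derivative_eq_intros)
  ultimately have "((\<lambda>t. orbit n (exp (s * t))) has_vector_derivative s *\<^sub>R velocity n) (at 0)"
    using vector_diff_chain_at[of "(*) s" s 0 "\<lambda>t. orbit n (exp t)" "velocity n"] by (simp add: o_def)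
  moreover have "((\<lambda>t. exp (s * t)) has_vector_derivative s) (at 0)"
    unfolding has_real_derivative_iff_has_vector_derivative[symmetric]
    by (auto intro!: derivative_eq_intros)
  ultimately show "((\<lambda>t. (orbit n (exp (s * t)), exp (s * t))) has_vector_derivative
      s *\<^sub>R (velocity n, 1)) (at 0)"
    by (auto dest: has_vector_derivative_Pair)
qed (auto simp: G_set_def gmul_def distrib_left exp_add orbit_mult)

text \<open>The functional equation carries the derivative from 0 to every \<open>t\<close>, so
  \<open>\<alpha> t * exp (- c * t)\<close> is constant.\<close>

lemma real_one_param_unique:
  fixes \<alpha> :: "real \<Rightarrow> real"
  assumes pos: "\<And>t. \<alpha> t > 0" and add: "\<And>s t. \<alpha> (s + t) = \<alpha> s * \<alpha> t"
    and deriv: "(\<alpha> has_real_derivative c) (at 0)"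
  shows "\<alpha> t = exp (c * t)"
proof -
  have 0: "\<alpha> 0 = 1" using add[of 0 0] pos[of 0] by simp
  have "(\<alpha> has_real_derivative \<alpha> t * c) (at t)" for t
  proof -
    have "((\<lambda>u. \<alpha> (t + u)) has_real_derivative \<alpha> t * c) (at 0)"
      unfolding add by (rule DERIV_cmult[OF deriv])
    then show ?thesis using DERIV_shift[of \<alpha> "\<alpha> t * c" 0 t] by (simp add: add.commute)
  qed
  then have "((\<lambda>t. \<alpha> t * exp (- c * t)) has_real_derivative 0) (at t)" for t
    by (auto intro!: derivative_eq_intros)
  then have "\<alpha> t * exp (- c * t) = \<alpha> 0 * exp (- c * 0)"
    by (rule DERIV_isconst_all[rule_format])
  then show ?thesis by (simp add: 0 exp_minus field_simps)
qed

text \<open>This gives meaning to the \<open>THE\<close> in \<open>exp_G\<close>. The second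
  components are the same exponential. For the first components, the quotient \<open>\<eta>\<close>
  has derivative 0 at 0, and \<open>\<eta>_add\<close> carries this to every time, so
  \<open>\<eta>\<close> stays at the identity.\<close>

lemma one_param_subgroup_unique:
  assumes "one_param_subgroup N W \<gamma>\<^sub>1" "one_param_subgroup N W \<gamma>\<^sub>2"
  shows "\<gamma>\<^sub>1 = \<gamma>\<^sub>2"
proof -
  have snd: "snd (\<gamma> t) = exp (snd W * t)" if "one_param_subgroup N W \<gamma>" for \<gamma> t
  proof (rule real_one_param_unique)
    show "((\<lambda>t. snd (\<gamma> t)) has_real_derivative snd W) (at 0)"
      using that bounded_linear.has_vector_derivative[OF bounded_linear_snd, of \<gamma> W]
      unfolding one_param_subgroup_def has_real_derivative_iff_has_vector_derivative by blast
  qed (use that in \<open>auto simp: one_param_subgroup_def gmul_def G_set_def mem_Times_iff\<close>)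
  define a \<zeta>\<^sub>1 \<zeta>\<^sub>2 where "a t = exp (snd W * t)" and "\<zeta>\<^sub>1 t = fst (\<gamma>\<^sub>1 t)" and "\<zeta>\<^sub>2 t = fst (\<gamma>\<^sub>2 t)" for t
  have a: "a t > 0" "a 0 = 1" for t by (auto simp: a_def)
  have \<zeta>_add: "\<zeta>\<^sub>1 (s + t) = mul N (\<zeta>\<^sub>1 s) (dil N (a s) (\<zeta>\<^sub>1 t))"
    "\<zeta>\<^sub>2 (s + t) = mul N (\<zeta>\<^sub>2 s) (dil N (a s) (\<zeta>\<^sub>2 t))" for s t
    using assms unfolding one_param_subgroup_def gmul_def \<zeta>\<^sub>1_def \<zeta>\<^sub>2_def a_def
      snd[OF assms(1), symmetric] by (auto simp: snd[OF assms(1)] snd[OF assms(2)])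
  have zero: "x = 0" if "x = mul N x x" for x
    using that mul_minus_cancel(1)[of x x] by simp
  have \<zeta>_0: "\<zeta>\<^sub>1 0 = 0" "\<zeta>\<^sub>2 0 = 0"
    using \<zeta>_add[of 0 0] by (auto intro: zero simp: a)
  have \<zeta>_deriv: "(\<zeta>\<^sub>1 has_vector_derivative fst W) (at 0)" "(\<zeta>\<^sub>2 has_vector_derivative fst W) (at 0)"
    using assms bounded_linear.has_vector_derivative[OF bounded_linear_fst]
    unfolding one_param_subgroup_def \<zeta>\<^sub>1_def \<zeta>\<^sub>2_def by blast+
  define \<eta> where "\<eta> t = mul N (\<zeta>\<^sub>1 t) (- \<zeta>\<^sub>2 t)" for t
  have mul_minus: "- mul N x y = mul N (- y) (- x)" for x y
    using mul_minus_cancel(1)[of "mul N x y" "mul N (- y) (- x)"]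
    by (metis mul_0_right mul_assoc mul_minus_cancel(2) mul_minus_right)
  have \<eta>_add: "\<eta> (s + t) = mul N (mul N (\<zeta>\<^sub>1 s) (dil N (a s) (\<eta> t))) (- \<zeta>\<^sub>2 s)" for s t
    using a by (simp add: \<eta>_def \<zeta>_add mul_minus automorphic dil_minus mul_assoc)
  have \<eta>_deriv_0: "(\<eta> has_vector_derivative 0) (at 0)"
    using mul_has_vector_derivative[OF \<zeta>_deriv(1) has_vector_derivative_minus[OF \<zeta>_deriv(2)]]
    unfolding \<eta>_def by (simp add: \<zeta>_0 mul_deriv_0)
  have bl: "bounded_linear (dil N c)" for c
    using linear_dil linear_conv_bounded_linear by blast
  have zero_deriv: "mul_deriv p (0, 0) = 0" for p
    using linear_0[OF linear_mul_deriv] by (simp add: zero_prod_def)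
  have "(\<eta> has_vector_derivative 0) (at s within UNIV)" for s
  proof -
    have "((\<lambda>t. \<eta> (s + t)) has_vector_derivative 0) (at 0)"
      unfolding \<eta>_add
      using mul_has_vector_derivative[OF mul_has_vector_derivative[OF has_vector_derivative_const
          bounded_linear.has_vector_derivative[OF bl \<eta>_deriv_0]] has_vector_derivative_const]
      by (simp add: zero_deriv)
    then have "((\<lambda>t. \<eta> (s + t)) \<circ> (\<lambda>t. t - s) has_vector_derivative 1 *\<^sub>R 0) (at s)"
      by (intro vector_diff_chain_at) (auto intro!: derivative_eq_intros)
    then show ?thesis by (simp add: o_def)
  qed
  then obtain c where "\<And>t. \<eta> t = c"
    using has_vector_derivative_zero_constant[of UNIV \<eta>] by auto
  then have "\<eta> t = 0" for t
    using \<zeta>_0 by (metis \<eta>_def minus_zero mul_0_left)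
  then have "\<zeta>\<^sub>1 t = \<zeta>\<^sub>2 t" for t
    using mul_minus_cancel(4)[of "\<zeta>\<^sub>1 t" "\<zeta>\<^sub>2 t"] by (simp add: \<eta>_def)
  then show ?thesis
    using snd assms by (auto simp: fun_eq_iff prod_eq_iff \<zeta>\<^sub>1_def \<zeta>\<^sub>2_def)
qed

lemma exp_G_eq: "exp_G N (t *\<^sub>R (velocity n, 1)) = (orbit n (exp t), exp t)"
proof -
  have "(THE \<gamma>. one_param_subgroup N (t *\<^sub>R (velocity n, 1)) \<gamma>) =
      (\<lambda>u. (orbit n (exp (t * u)), exp (t * u)))"
    using one_param_subgroup_orbit one_param_subgroup_unique by (intro the_equality) blast+
  then show ?thesis by (simp add: exp_G_def)
qed


section \<open>Flow coordinates\<close>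

text \<open>The coordinates \<open>(n, t) \<mapsto> (n, 1) exp(tZ)\<close>; \<open>m\<close> is the point such that \<open>exp(tZ)\<close> is conjugate
  to \<open>exp(t X\<^sub>0)\<close> by \<open>(m, 1)\<close>.\<close>

definition flow :: "'a \<Rightarrow> 'a \<times> real \<Rightarrow> 'a \<times> real" where
  "flow m = (\<lambda>(n, t). (mul N n (orbit m (exp t)), exp t))"

definition flow_inv :: "'a \<Rightarrow> 'a \<times> real \<Rightarrow> 'a \<times> real" where
  "flow_inv m = (\<lambda>(n, a). (mul N n (- orbit m a), ln a))"

text \<open>The scalar product with \<open>X_0 = (0, 1)\<close> is just \<open>snd Z\<close>, so
  \<open>Z = (fst Z, 1)\<close>, and \<open>surj_velocity\<close> provides the conjugating point
  \<open>m\<close>.\<close>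

lemma obtain_flow:
  assumes "Z \<in> Z_set N"
  obtains m where "\<And>n t. gmul N (n, 1) (exp_G N (t *\<^sub>R Z)) = flow m (n, t)"
proof -
  have "representation (n_basis N) 0 = (\<lambda>b. 0)"
    unfolding representation_def by (auto simp: representation_zero[unfolded representation_def] fun_eq_iff)
  with assms have "snd Z = 1"
    by (simp add: Z_set_def g_inner_def)
  moreover obtain m where "velocity m = fst Z" using surj_velocity by blast
  ultimately have "Z = (velocity m, 1)" by (simp add: prod_eq_iff)
  then show ?thesis
    by (intro that[of m]) (simp add: exp_G_eq gmul_def flow_def del: scaleR_Pair)
qed

lemma flow_inv_flow [simp]: "flow_inv m (flow m x) = x"
  by (simp add: flow_def flow_inv_def case_prod_unfold)

lemma flow_flow_inv: "x \<in> G_set \<Longrightarrow> flow m (flow_inv m x) = x"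
  by (auto simp: flow_def flow_inv_def G_set_def)

lemma flow_in_G_set [simp]: "flow m x \<in> G_set"
  by (auto simp: flow_def G_set_def case_prod_unfold)

lemma inj_flow: "inj (flow m)"
  by (metis flow_inv_flow injI)

lemma continuous_flow: "continuous_on UNIV (flow m)"
  unfolding flow_def case_prod_unfold by (intro continuous_intros)

text \<open>The image is the preimage of \<open>S\<close> under \<open>flow_inv m\<close>, which is
  continuous on the open set \<open>G_set\<close>.\<close>

lemma open_flow_image:
  assumes "open S"
  shows "open (flow m ` S)"
proof -
  have "open (G_set :: ('a \<times> real) set)"
    unfolding G_set_def by (intro open_Times) auto
  moreover have "continuous_on G_set (flow_inv m)"
    unfolding flow_inv_def case_prod_unfold by (intro continuous_intros) (auto simp: G_set_def)
  ultimately have "open (G_set \<inter> flow_inv m -` S)"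
    using continuous_open_preimage assms by blast
  moreover have "G_set \<inter> flow_inv m -` S = flow m ` S"
    by (auto simp: image_iff) (metis flow_flow_inv)
  ultimately show ?thesis by simp
qed

end

section \<open>The flow measure as a product measure in flow coordinates\<close>

lemma nn_integral_exp_substitution:
  assumes [measurable]: "H \<in> borel_measurable borel"
  shows "(\<integral>\<^sup>+a. (if a > 0 then ennreal (1 / a) else 0) * H a \<partial>lborel) = (\<integral>\<^sup>+t. H (exp t) \<partial>lborel)"
proof -
  define w where "w a = (if a > 0 then ennreal (1 / a) else 0) * H a" for a :: real
  have [measurable]: "w \<in> borel_measurable borel" unfolding w_def by measurable
  \<comment> \<open>The substitution \<open>a = exp t\<close> is made on these compact intervals and
    extended by continuity from below. For \<open>n = 0\<close> both are single points and both
    measures vanish.\<close>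
  let ?A = "\<lambda>n::nat. {exp (- real n)..exp (real n)}" and ?B = "\<lambda>n::nat. {- real n..real n}"
  have A: "(\<Union>n. ?A n) = {0<..}"
  proof safe
    fix x :: real assume "x > 0"
    obtain n :: nat where "\<bar>ln x\<bar> \<le> real n" using real_arch_simple by blast
    then have "exp (- real n) \<le> exp (ln x)" "exp (ln x) \<le> exp (real n)" by auto
    with \<open>x > 0\<close> show "x \<in> (\<Union>n. ?A n)" by auto
  next
    fix x :: real and n :: nat assume "x \<in> ?A n"
    then show "x > 0" using less_le_trans[OF exp_gt_zero, of "- real n" x] by simp
  qed
  have B: "(\<Union>n. ?B n) = UNIV"
  proof -
    have "x \<in> (\<Union>n. ?B n)" for x :: real
    proof -
      obtain n :: nat where "\<bar>x\<bar> \<le> real n" using real_arch_simple by blast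
      then have "x \<in> ?B n" by auto
      then show ?thesis by blast
    qed
    then show ?thesis by blast
  qed
  have eq: "emeasure (density lborel w) (?A n) = emeasure (density lborel (\<lambda>t. H (exp t))) (?B n)" for n
  proof (cases "n = 0")
    case False
    have "(\<integral>\<^sup>+x. w x * indicator (?A n) x \<partial>lborel) =
        (\<integral>\<^sup>+x. w (exp x) * ennreal (exp x) * indicator (?B n) x \<partial>lborel)"
      by (rule nn_integral_substitution_aux)
        (use False in \<open>auto intro!: derivative_eq_intros continuous_intros\<close>)
    also have "\<dots> = (\<integral>\<^sup>+x. H (exp x) * indicator (?B n) x \<partial>lborel)"
    proof (rule nn_integral_cong)
      fix x :: real
      have "ennreal (1 / exp x) * ennreal (exp x) = 1"
        by (simp flip: ennreal_mult')
      moreover have "w (exp x) * ennreal (exp x) = ennreal (1 / exp x) * ennreal (exp x) * H (exp x)"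
        unfolding w_def by (simp only: exp_gt_zero if_True mult_ac)
      ultimately show "w (exp x) * ennreal (exp x) * indicator (?B n) x = H (exp x) * indicator (?B n) x"
        by (simp only: mult_1)
    qed
    finally show ?thesis by (simp add: emeasure_density)
  qed (simp add: emeasure_density nn_integral_null_set null_sets_def)
  have "(\<integral>\<^sup>+a. w a \<partial>lborel) = emeasure (density lborel w) (\<Union>n. ?A n)"
    unfolding A by (subst emeasure_density) (auto intro!: nn_integral_cong simp: w_def split: split_indicator)
  also have "\<dots> = (SUP n. emeasure (density lborel w) (?A n))"
    by (rule SUP_emeasure_incseq[symmetric]) (auto simp: incseq_def)
  also have "\<dots> = (SUP n. emeasure (density lborel (\<lambda>t. H (exp t))) (?B n))"
    by (simp add: eq)
  also have "\<dots> = emeasure (density lborel (\<lambda>t. H (exp t))) (\<Union>n. ?B n)"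
    by (rule SUP_emeasure_incseq) (auto simp: incseq_def)
  also have "\<dots> = (\<integral>\<^sup>+t. H (exp t) \<partial>lborel)"
    unfolding B by (simp add: emeasure_density)
  finally show ?thesis by (simp add: w_def)
qed

context stratified_group
begin

text \<open>After Fubini, \<open>a = exp t\<close> absorbs the factor \<open>1 / a\<close>, right
  invariance of Lebesgue measure replaces \<open>(n, exp t)\<close> by \<open>flow m (n, t)\<close>,
  and flow invariance of \<open>\<phi>\<close> replaces its value there by
  \<open>\<phi> (n, 1)\<close>.\<close>

lemma flow_density_eq_distr:
  assumes dens: "flow_density N Z \<mu> \<phi>"
    and m: "\<And>n t. gmul N (n, 1) (exp_G N (t *\<^sub>R Z)) = flow m (n, t)"
  shows "\<mu> = distr (density lborel (\<lambda>n. ennreal (\<phi> (n, 1))) \<Otimes>\<^sub>M lborel) borel (flow m)"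
    (is "_ = distr (?M \<Otimes>\<^sub>M _) _ _")
proof (rule measure_eqI)
  have \<phi>[measurable]: "\<phi> \<in> borel_measurable borel" and \<mu>: "\<mu> = density right_haar (\<lambda>x. ennreal (\<phi> x))"
    using dens by (auto simp: flow_density_def)
  have \<phi>_flow: "\<phi> (flow m (n, t)) = \<phi> (n, 1)" for n t
    using dens unfolding m[symmetric] by (simp add: flow_density_def G_set_def)
  show sets: "sets \<mu> = sets (distr (?M \<Otimes>\<^sub>M lborel) borel (flow m))"
    by (simp add: \<mu> right_haar_def)
  have [measurable]: "(\<lambda>n. \<phi> (n, 1)) \<in> borel_measurable borel"
    by (intro measurable_compose[OF _ \<phi>] borel_measurable_continuous_onI continuous_intros)
  have "(\<lambda>n. ennreal (\<phi> (n, 1))) \<in> borel_measurable lborel"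
    by simp
  from sigma_finite_measure.sigma_finite_iff_density_finite[OF sigma_finite_lborel this]
  interpret M: sigma_finite_measure ?M
    by simp
  interpret P: pair_sigma_finite ?M lborel ..
  have flow_meas[measurable]: "flow m \<in> borel_measurable borel"
    by (rule borel_measurable_continuous_onI[OF continuous_flow])
  have sets_prod: "sets (?M \<Otimes>\<^sub>M lborel) = sets (borel :: ('a \<times> real) measure)"
    by (simp add: borel_prod[symmetric] cong: sets_pair_measure_cong)
  have space_prod: "space (?M \<Otimes>\<^sub>M lborel) = (UNIV :: ('a \<times> real) set)"
    by (simp add: space_pair_measure)
  fix A assume "A \<in> sets \<mu>"
  then have A[measurable]: "A \<in> sets borel" by (simp add: \<mu> right_haar_def)
  define f :: "'a \<times> real \<Rightarrow> ennreal" where "f x = ennreal (\<phi> x) * indicator A x" for x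
  define w :: "real \<Rightarrow> ennreal" where "w a = (if a > 0 then ennreal (1 / a) else 0)" for a
  have [measurable]: "f \<in> borel_measurable borel" unfolding f_def by measurable
  then have [measurable]: "f \<in> borel_measurable (borel \<Otimes>\<^sub>M borel)" by (simp add: borel_prod)
  have [measurable]: "w \<in> borel_measurable borel" unfolding w_def by measurable
  have w: "(\<lambda>(n::'a, a). if a > 0 then ennreal (1 / a) else 0) = (\<lambda>x. w (snd x))"
    by (auto simp: w_def fun_eq_iff)
  have "emeasure \<mu> A = (\<integral>\<^sup>+x. f x \<partial>right_haar)"
    unfolding \<mu> f_def by (subst emeasure_density) (auto simp: right_haar_def)
  also have "\<dots> = (\<integral>\<^sup>+x. w (snd x) * f x \<partial>lborel)"
    unfolding right_haar_def w by (subst nn_integral_density) (auto simp flip: borel_prod)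
  also have "\<dots> = (\<integral>\<^sup>+x. w (snd x) * f x \<partial>(lborel \<Otimes>\<^sub>M lborel))"
    by (simp add: lborel_prod)
  also have "\<dots> = (\<integral>\<^sup>+a. \<integral>\<^sup>+n. w a * f (n, a) \<partial>lborel \<partial>lborel)"
    by (subst lborel_pair.nn_integral_snd[symmetric]) (auto simp: case_prod_unfold)
  also have "\<dots> = (\<integral>\<^sup>+a. w a * (\<integral>\<^sup>+n. f (n, a) \<partial>lborel) \<partial>lborel)"
    by (subst nn_integral_cmult) auto
  also have "\<dots> = (\<integral>\<^sup>+t. \<integral>\<^sup>+n. f (n, exp t) \<partial>lborel \<partial>lborel)"
    unfolding w_def by (rule nn_integral_exp_substitution) simp
  also have "\<dots> = (\<integral>\<^sup>+t. \<integral>\<^sup>+n. f (flow m (n, t)) \<partial>lborel \<partial>lborel)"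
    by (simp add: flow_def nn_integral_right_mul[of "\<lambda>n. f (n, exp _)"])
  also have "\<dots> = (\<integral>\<^sup>+t. emeasure ?M ((\<lambda>n. (n, t)) -` (flow m -` A)) \<partial>lborel)"
  proof (rule nn_integral_cong)
    fix t
    have "(\<lambda>n. flow m (n, t)) \<in> borel_measurable borel"
      by (intro borel_measurable_continuous_onI continuous_on_compose2[OF continuous_flow] continuous_intros) auto
    from measurable_sets[OF this A]
    have "(\<lambda>n. (n, t)) -` (flow m -` A) \<in> sets borel"
      by (simp add: vimage_def)
    then show "(\<integral>\<^sup>+n. f (flow m (n, t)) \<partial>lborel) = emeasure ?M ((\<lambda>n. (n, t)) -` (flow m -` A))"
      by (subst emeasure_density)
        (auto intro!: nn_integral_cong simp: f_def \<phi>_flow split: split_indicator)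
  qed
  also have "\<dots> = emeasure (?M \<Otimes>\<^sub>M lborel) (flow m -` A)"
    using measurable_sets[OF flow_meas A] sets_prod by (subst P.emeasure_pair_measure_alt2) auto
  also have "\<dots> = emeasure (distr (?M \<Otimes>\<^sub>M lborel) borel (flow m)) A"
    by (subst emeasure_distr) (auto simp: space_prod cong: measurable_cong_sets[OF sets_prod refl])
  finally show "emeasure \<mu> A = emeasure (distr (?M \<Otimes>\<^sub>M lborel) borel (flow m)) A" .
qed

end


section \<open>Dyadic intervals and the generations attached to them\<close>

text \<open>The dyadic intervals of scale \<open>j\<close> have half-length \<open>2\<^sup>j\<close>; the one of index \<open>i\<close> is contained in
  the one of scale \<open>j + 1\<close> and index \<open>i div 2\<close>.\<close>

definition ival :: "int \<Rightarrow> int \<Rightarrow> real set" where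
  "ival j i = {2 * of_int i * 2 powi j<..<2 * (of_int i + 1) * 2 powi j}"

definition index :: "int \<Rightarrow> real \<Rightarrow> int" where
  "index j t = \<lfloor>t / (2 * 2 powi j)\<rfloor>"

text \<open>With \<open>r = exp (2 powi j)\<close> this is the logarithm of the factor of
  \<open>a\<close> in the lower admissibility bound: of \<open>r\<^sup>2\<close> for large cylinders
  and of \<open>(exp 1)\<^sup>2 * ln r\<close> for small ones. The condition \<open>j > 0\<close>
  means \<open>r > exp 1\<close>.\<close>

definition lower :: "int \<Rightarrow> real" where
  "lower j = (if j > 0 then 2 * 2 powi j else 2 + of_int j * ln 2)"

text \<open>With \<open>\<kappa> = - ln \<delta>\<close>, this is the largest \<open>g\<close> for which cubes of generation \<open>g\<close> satisfy the lower
  admissibility bound over the given interval.\<close>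

definition top_gen :: "real \<Rightarrow> int \<Rightarrow> int \<Rightarrow> int" where
  "top_gen \<kappa> j i = \<lfloor>- ((2 * of_int i + 1) * 2 powi j + lower j) / \<kappa>\<rfloor>"

text \<open>In the tree of boxes \<open>Q \<times> I\<close>, a box is divided across \<open>Q\<close> as long as this is admissible, and
  across \<open>I\<close> otherwise.  Hence the generations \<open>g\<close> occurring over the interval \<open>(j, i)\<close> range from the
  top generation of its parent interval to its own, and \<open>k = g - j\<close> increases by \<open>1\<close> at each division.\<close>

definition active :: "real \<Rightarrow> int \<Rightarrow> int \<Rightarrow> int \<Rightarrow> bool" where
  "active \<kappa> k j i \<longleftrightarrow> top_gen \<kappa> (j + 1) (i div 2) \<le> k + j \<and> k + j \<le> top_gen \<kappa> j i"

section \<open>Nesting of dyadic intervals\<close>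

lemma powi_Suc: "2 powi (j + 1) = 2 * (2 powi j :: real)"
  by (simp add: power_int_add_1)

lemma powi_ge: "0 < j \<Longrightarrow> 2 \<le> (2 powi j :: real)"
  using power_int_increasing[of 1 j "2 :: real"] by simp

lemma powi_le: "j \<le> 0 \<Longrightarrow> (2 powi j :: real) \<le> 1"
  using power_int_increasing[of j 0 "2 :: real"] by simp

lemma powi_le_half: "j < 0 \<Longrightarrow> (2 powi j :: real) \<le> 1 / 2"
  using power_int_increasing[of j "-1" "2 :: real"] by simp

lemma index_Suc: "index (j + 1) t = index j t div 2"
proof -
  have "t / (2 * 2 powi (j + 1)) = t / (2 * 2 powi j) / real_of_int 2"
    by (simp add: powi_Suc)
  then show ?thesis
    unfolding index_def by (simp only: floor_divide_real_eq_div)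
qed

lemma index_eq: "t \<in> ival j i \<Longrightarrow> index j t = i"
  unfolding ival_def index_def by (intro floor_unique) (auto simp: field_simps)

lemma in_ival_index:
  assumes "\<And>i. t \<noteq> 2 * of_int i * 2 powi j"
  shows "t \<in> ival j (index j t)"
proof -
  have "of_int (index j t) \<le> t / (2 * 2 powi j)" "t / (2 * 2 powi j) < of_int (index j t) + 1"
    unfolding index_def by linarith+
  then have "2 * of_int (index j t) * 2 powi j \<le> t" "t < 2 * (of_int (index j t) + 1) * 2 powi j"
    by (simp_all add: field_simps)
  with assms[of "index j t"] show ?thesis by (simp add: ival_def)
qed

text \<open>The centre of the parent is the end point shared by its two halves, hence an end point
  of the interval \<open>(j, i)\<close>.\<close>

lemma parent_center:
  "2 * of_int i * 2 powi j \<le> (2 * of_int (i div 2) + 1) * (2 powi (j + 1) :: real)"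
  "(2 * of_int (i div 2) + 1) * (2 powi (j + 1) :: real) \<le> (2 * of_int i + 2) * 2 powi j"
proof -
  have "i \<le> 2 * (i div 2) + 1" "2 * (i div 2) \<le> i" by auto
  then have "real_of_int i \<le> 2 * of_int (i div 2) + 1" "2 * real_of_int (i div 2) \<le> of_int i"
    by linarith+
  then show "2 * of_int i * 2 powi j \<le> (2 * of_int (i div 2) + 1) * (2 powi (j + 1) :: real)"
    "(2 * of_int (i div 2) + 1) * (2 powi (j + 1) :: real) \<le> (2 * of_int i + 2) * 2 powi j"
    unfolding powi_Suc by (simp_all add: mult_right_mono flip: mult.assoc)
qed

lemma ival_subset_parent: "ival j i \<subseteq> ival (j + 1) (i div 2)"
proof -
  have "2 * (i div 2) \<le> i" "i + 1 \<le> 2 * (i div 2 + 1)" by auto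
  then have "real_of_int (2 * (i div 2)) \<le> of_int i" "real_of_int (i + 1) \<le> of_int (2 * (i div 2 + 1))"
    by (simp_all only: of_int_le_iff)
  then have "2 * (2 * of_int (i div 2)) * 2 powi j \<le> 2 * of_int i * (2 powi j :: real)"
    "2 * (of_int i + 1) * 2 powi j \<le> 2 * (2 * (of_int (i div 2) + 1)) * (2 powi j :: real)"
    by (intro mult_right_mono mult_left_mono; simp)+
  moreover have "2 * of_int (i div 2) * (2 * 2 powi j) = 2 * (2 * of_int (i div 2)) * (2 powi j :: real)"
    "2 * (of_int (i div 2) + 1) * (2 * 2 powi j) = 2 * (2 * (of_int (i div 2) + 1)) * (2 powi j :: real)"
    by (simp_all only: mult_ac)
  ultimately show ?thesis
    unfolding ival_def powi_Suc
    by - (intro subsetI, simp only: greaterThanLessThan_iff, linarith)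
qed

lemma ival_nonempty: "ival j i \<noteq> {}"
  by (simp add: ival_def)

lemma emeasure_ival: "emeasure lborel (ival j i) = ennreal (2 * 2 powi j)"
  unfolding ival_def by (subst emeasure_lborel_Ioo) (auto simp: algebra_simps)

lemma ival_scale_inj:
  assumes "ival j i = ival j' i'"
  shows "j = j'"
proof -
  have "(2 powi j :: real) = 2 powi j'"
    using arg_cong[OF assms, of "emeasure lborel"] by (simp add: emeasure_ival)
  then show ?thesis
    using power_int_strict_increasing[of j j' "2::real"] power_int_strict_increasing[of j' j "2::real"]
    by (metis linorder_cases less_irrefl one_less_numeral_iff semiring_norm(76))
qed

text \<open>The centre of an interval exceeds that of its parent by at most \<open>2 powi j\<close>;
  this growth of \<open>lower\<close> compensates for it in \<open>top_gen_parent\<close>. For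
  \<open>j < 0\<close> it reduces to \<open>2 powi j \<le> 1 / 2 \<le> ln 2\<close>.\<close>

lemma lower_Suc: "lower j + 2 powi j \<le> lower (j + 1)"
proof -
  consider "j > 0" | "j = 0" | "j < 0" by linarith
  then show ?thesis
  proof cases
    case 3
    moreover have "(1 / 2 :: real) \<le> ln 2"
      using ln_ge_iff[of 2 "1 / 2"] exp_half_le2 by simp
    ultimately show ?thesis
      using powi_le_half[of j] by (simp add: lower_def algebra_simps)
  qed (simp_all add: lower_def powi_Suc)
qed

lemma top_gen_parent:
  assumes "\<kappa> > 0"
  shows "top_gen \<kappa> (j + 1) (i div 2) \<le> top_gen \<kappa> j i"
  unfolding top_gen_def
proof (intro floor_mono divide_right_mono)
  show "- ((2 * of_int (i div 2) + 1) * 2 powi (j + 1) + lower (j + 1))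
      \<le> - ((2 * real_of_int i + 1) * 2 powi j + lower j)"
    using parent_center(1)[of i j] lower_Suc[of j] by (simp add: algebra_simps)
qed (use assms in simp)

text \<open>Along the intervals of index \<open>index j t\<close>, the function \<open>f\<close> is
  strictly decreasing in \<open>j\<close>, and \<open>active\<close> says
  \<open>f (j + 1) < k \<le> f j\<close>. The scale sought is the last one with
  \<open>k \<le> f j\<close>.\<close>

lemma active_ex:
  assumes \<kappa>: "\<kappa> > 0"
  shows "\<exists>j. active \<kappa> k j (index j t)"
proof -
  define f where "f j = top_gen \<kappa> j (index j t) - j" for j
  have step: "f (j + 1) + 1 \<le> f j" for j
    using top_gen_parent[OF \<kappa>, of j "index j t"] by (simp add: f_def index_Suc)
  have down: "f (j + int n) + int n \<le> f j" for j n
  proof (induction n)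
    case (Suc n)
    then show ?case using step[of "j + int n"] by (simp add: algebra_simps)
  qed simp
  \<comment> \<open>By \<open>down\<close>, \<open>f (- n) \<ge> f 0 + n\<close>, so the starting
    scale \<open>- \<bar>k - f 0\<bar>\<close> is low enough for \<open>0 \<in> S\<close>.\<close>
  define S where "S = {n :: nat. k \<le> f (- \<bar>k - f 0\<bar> + int n)}"
  have "0 \<in> S"
    using down[of "- \<bar>k - f 0\<bar>" "nat \<bar>k - f 0\<bar>"] by (simp add: S_def)
  moreover have "n \<le> nat (f (- \<bar>k - f 0\<bar>) - k)" if "n \<in> S" for n
    using down[of "- \<bar>k - f 0\<bar>" n] that by (simp add: S_def)
  then have "finite S" by (meson finite_nat_set_iff_bounded_le)
  ultimately have "Max S \<in> S" "Suc (Max S) \<notin> S"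
    by (auto intro: Max_in dest: Max_ge[of S "Suc (Max S)"])
  then have "active \<kappa> k (- \<bar>k - f 0\<bar> + int (Max S)) (index (- \<bar>k - f 0\<bar> + int (Max S)) t)"
    by (simp add: S_def f_def active_def index_Suc[symmetric] algebra_simps)
  then show ?thesis ..
qed

text \<open>Since \<open>f\<close> decreases, the ranges \<open>f (j + 1) < k \<le> f j\<close> for
  different \<open>j\<close> are disjoint, so \<open>k\<close> and \<open>t\<close> determine the
  scale, and \<open>t\<close> then determines the index.\<close>

lemma active_unique:
  assumes \<kappa>: "\<kappa> > 0" and "active \<kappa> k j i" "active \<kappa> k j' i'" "t \<in> ival j i" "t \<in> ival j' i'"
  shows "j = j' \<and> i = i'"
proof -
  define f where "f j = top_gen \<kappa> j (index j t) - j" for j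
  have step: "f (j + 1) + 1 \<le> f j" for j
    using top_gen_parent[OF \<kappa>, of j "index j t"] by (simp add: f_def index_Suc)
  have down: "f (j + int n) \<le> f j" for j n
  proof (induction n)
    case (Suc n)
    then show ?case using step[of "j + int n"] by (simp add: algebra_simps)
  qed simp
  have i: "i = index j t" "i' = index j' t"
    using assms index_eq by auto
  have "f (j + 1) < k" "k \<le> f j" "f (j' + 1) < k" "k \<le> f j'"
    using assms(2,3) by (auto simp: active_def f_def i index_Suc)
  then have "\<not> j < j'" "\<not> j' < j"
    using down[of "j + 1" "nat (j' - (j + 1))"] down[of "j' + 1" "nat (j - (j' + 1))"] by auto
  with i show ?thesis by auto
qed

text \<open>All bounds are compared through logarithms: \<open>K\<close> is that of
  \<open>\<delta> powi (k + j)\<close>, \<open>\<tau>\<close> that of \<open>a\<close> and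
  \<open>h\<close> that of \<open>r\<close>. The assumption on \<open>lam\<close> says
  \<open>lam > exp (3 + \<kappa>)\<close>.\<close>

lemma active_admissible:
  assumes \<delta>: "0 < \<delta>" "\<delta> < 1" and \<gamma>: "\<gamma> \<ge> 5" and lam: "lam > exp 3 / \<delta>"
    and act: "active (- ln \<delta>) k j i"
  shows "large_params \<delta> \<gamma> lam (k + j) (exp (2 powi j)) (exp ((2 * of_int i + 1) * 2 powi j)) \<or>
    small_params \<delta> lam (k + j) (exp (2 powi j)) (exp ((2 * of_int i + 1) * 2 powi j))"
proof -
  define \<kappa> h \<tau> K where "\<kappa> = - ln \<delta>" and "h = (2 powi j :: real)"
    and "\<tau> = (2 * of_int i + 1) * h" and "K = - of_int (k + j) * \<kappa>"
  have \<kappa>: "\<kappa> > 0" using \<delta> by (simp add: \<kappa>_def)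
  have h: "h > 0" by (simp add: h_def)
  have \<delta>_powi: "\<delta> powi (k + j) = exp K"
  proof -
    have "\<delta> powi (k + j) = \<delta> powr of_int (k + j)"
      using \<delta> by (intro powr_real_of_int'[symmetric]) auto
    also have "\<dots> = exp K"
      using \<delta> by (simp only: powr_def K_def \<kappa>_def minus_mult_minus) simp
    finally show ?thesis .
  qed
  have lam': "exp (3 + \<kappa>) < lam"
    using lam \<delta> by (simp add: \<kappa>_def exp_diff)
  have low: "\<tau> + lower j \<le> K"
  proof -
    have "of_int (k + j) \<le> - (\<tau> + lower j) / \<kappa>"
      using act by (simp add: active_def top_gen_def le_floor_iff \<kappa>_def \<tau>_def h_def)
    then have "of_int (k + j) * \<kappa> \<le> - (\<tau> + lower j)"
      using \<kappa> by (simp add: pos_le_divide_eq)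
    then show ?thesis by (simp add: K_def algebra_simps)
  qed
  \<comment> \<open>The left bound in \<open>active\<close> concerns the parent interval, whose
    centre is at most \<open>\<tau> + h\<close>; the floor costs one more
    \<open>\<kappa>\<close>.\<close>
  have up: "K < \<tau> + h + lower (j + 1) + \<kappa>"
  proof -
    let ?\<tau>' = "(2 * of_int (i div 2) + 1) * (2 powi (j + 1) :: real)"
    have "- (?\<tau>' + lower (j + 1)) / \<kappa> < of_int (k + j) + 1"
      using act unfolding active_def top_gen_def \<kappa>_def by linarith
    then have "- (?\<tau>' + lower (j + 1)) < (of_int (k + j) + 1) * \<kappa>"
      using \<kappa> by (simp add: pos_divide_less_eq)
    moreover have "?\<tau>' \<le> \<tau> + h"
      using parent_center(2)[of i j] by (simp add: \<tau>_def h_def algebra_simps)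
    ultimately show ?thesis by (simp add: K_def algebra_simps)
  qed
  show ?thesis
  proof (cases "j > 0")
    case True
    then have "h \<ge> 2" by (simp add: h_def powi_ge)
    have "exp K \<le> lam * exp \<tau> * exp h powr \<gamma>"
    proof -
      \<comment> \<open>Here \<open>\<gamma> \<ge> 5\<close> enters:
        \<open>h + lower (j + 1) = h + 4 * h\<close>.\<close>
      have "5 * h \<le> \<gamma> * h" using \<gamma> h by simp
      moreover have "lower (j + 1) = 4 * h"
        using True by (simp add: lower_def powi_Suc h_def)
      ultimately have "K \<le> 3 + \<kappa> + \<tau> + \<gamma> * h"
        using up by linarith
      then have "exp K \<le> exp (3 + \<kappa>) * (exp \<tau> * exp (\<gamma> * h))"
        by (simp flip: exp_add add: algebra_simps)
      also have "\<dots> \<le> lam * (exp \<tau> * exp (\<gamma> * h))"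
        using lam' by (intro mult_right_mono) auto
      finally show ?thesis by (simp add: powr_def mult_ac)
    qed
    moreover have "exp \<tau> * (exp h)\<^sup>2 \<le> exp K"
      using low True by (simp add: lower_def h_def flip: exp_add exp_double)
    ultimately show ?thesis
      using \<open>h \<ge> 2\<close> by (simp add: large_params_def \<delta>_powi \<tau>_def h_def)
  next
    case False
    then have "h \<le> 1" by (simp add: h_def powi_le)
    have h_eq: "h = exp (of_int j * ln 2)"
      using powr_real_of_int'[of 2 j] by (simp add: h_def powr_def)
    have eq: "exp \<tau> * (exp 1)\<^sup>2 * h = exp (\<tau> + 2 + of_int j * ln 2)"
      by (simp add: h_eq exp_add flip: exp_double)
    have "exp \<tau> * (exp 1)\<^sup>2 * h \<le> exp K"
      unfolding eq using low False by (simp add: lower_def)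
    moreover have "exp K \<le> lam * exp \<tau> * (exp 1)\<^sup>2 * h"
    proof -
      \<comment> \<open>The 5 splits into the 3 absorbed by \<open>lam\<close> and the 2 of
        \<open>lower j\<close>. At \<open>j = 0\<close>, where the parent is already large, equality
        holds.\<close>
      have "h + lower (j + 1) \<le> 5 + of_int j * ln 2"
      proof (cases "j = 0")
        case False
        with \<open>\<not> j > 0\<close> have "j < 0" by simp
        then show ?thesis
          using \<open>h \<le> 1\<close> ln_2_less_1 by (simp add: lower_def algebra_simps)
      qed (simp add: lower_def h_def)
      then have "exp K \<le> exp (3 + \<kappa> + (\<tau> + 2 + of_int j * ln 2))"
        using up by simp
      also have "\<dots> = exp (3 + \<kappa>) * (exp \<tau> * (exp 1)\<^sup>2 * h)"
        by (simp only: eq exp_add)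
      also have "\<dots> \<le> lam * (exp \<tau> * (exp 1)\<^sup>2 * h)"
        using lam' h by (intro mult_right_mono) auto
      finally show ?thesis by (simp add: mult_ac)
    qed
    ultimately show ?thesis
      using \<open>h \<le> 1\<close> h by (simp add: small_params_def \<delta>_powi \<tau>_def h_def)
  qed
qed


section \<open>Christ cubes\<close>

context christ_cubes
begin

lemma cube_nonempty: "Q \<in> \<Q> k \<Longrightarrow> Q \<noteq> {}"
  using balls by blast

lemma sibling:
  assumes "Q \<in> \<Q> k"
  obtains Q' where "Q' \<in> \<Q> k" "pN k Q' = pN k Q" "Q \<inter> Q' = {}"
proof -
  have "pN k Q \<in> \<Q> (k - 1)" using parent[OF assms] by simp
  from children_ge_2[OF this]
  have "\<not> cube_children \<Q> pN (k - 1) (pN k Q) \<subseteq> {Q}"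
    using card_mono[of "{Q}" "cube_children \<Q> pN (k - 1) (pN k Q)"] by auto
  then obtain Q' where "Q' \<in> \<Q> k" "pN k Q' = pN k Q" "Q' \<noteq> Q"
    by (auto simp: cube_children_def)
  with that[of Q'] disjointD[OF disjoint assms, of Q'] show ?thesis by blast
qed

lemma cube_psubset_parent: "Q \<in> \<Q> k \<Longrightarrow> Q \<subset> pN k Q"
  using parent sibling[of Q k] cube_nonempty by (metis inf.absorb_iff2 inf.strict_order_iff inf_commute)

lemma ancestor:
  assumes "Q \<in> \<Q> k"
  shows "\<exists>R\<in>\<Q> (k - int (Suc n)). Q \<subset> R"
proof (induction n)
  case 0
  then show ?case using parent[OF assms] cube_psubset_parent[OF assms] by auto
next
  case (Suc n)
  then obtain R where "R \<in> \<Q> (k - int (Suc n))" "Q \<subset> R" by blast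
  with parent[of R "k - int (Suc n)"] show ?case
    by (intro bexI[of _ "pN (k - int (Suc n)) R"]) (auto simp: algebra_simps)
qed

text \<open>A cube is strictly contained in each of its ancestors, since the parent also contains a
  disjoint nonempty sibling; an equal cube of the ancestor's generation would contradict
  disjointness.\<close>

lemma generation_unique:
  assumes "Q \<in> \<Q> k" "Q \<in> \<Q> l"
  shows "k = l"
proof -
  have False if kl: "Q \<in> \<Q> k" "Q \<in> \<Q> l" "l < k" for k l
  proof -
    obtain R where "R \<in> \<Q> l" "Q \<subset> R"
      using ancestor[OF kl(1), of "nat (k - l) - 1"] kl(3) by auto
    then show False
      using disjointD[OF disjoint kl(2), of R] cube_nonempty[OF kl(2)] by blast
  qed
  with assms show ?thesis by (metis linorder_neqE)
qed

end


section \<open>The dyadic system of cylinders\<close>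

text \<open>\<open>\<Phi>\<close> stands for the flow coordinates \<open>(n, t) \<mapsto> (n, 1) exp(tZ)\<close>, in which the flow measure is
  the product of \<open>M\<close> with Lebesgue measure.\<close>

locale cube_flow = christ_cubes N M \<Q> pN \<delta> C\<^sub>1 c
  for N :: "'a::euclidean_space stratified" and M \<Q> pN \<delta> C\<^sub>1 c +
  fixes \<Phi> :: "'a \<times> real \<Rightarrow> 'a \<times> real" and \<mu> :: "('a \<times> real) measure"
  assumes sigma_finite: "sigma_finite_measure M" and sets_M: "sets M = sets borel"
    and inj: "inj \<Phi>"
    and open_image: "open S \<Longrightarrow> open (\<Phi> ` S)" and continuous: "continuous_on UNIV \<Phi>"
    and \<mu>_eq: "\<mu> = distr (M \<Otimes>\<^sub>M lborel) borel \<Phi>"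
    and cube_pos: "Q \<in> \<Q> k \<Longrightarrow> 0 < emeasure M Q"
    and cube_finite: "Q \<in> \<Q> k \<Longrightarrow> emeasure M Q < \<infinity>"
begin

definition "\<kappa> = - ln \<delta>"

lemma \<kappa>_pos: "\<kappa> > 0"
  using delta by (simp add: \<kappa>_def)

definition boxes :: "int \<Rightarrow> (int \<times> int \<times> 'a set) set" where
  "boxes k = {(j, i, Q). active \<kappa> k j i \<and> Q \<in> \<Q> (k + j)}"

definition box_set :: "int \<times> int \<times> 'a set \<Rightarrow> ('a \<times> real) set" where
  "box_set = (\<lambda>(j, i, Q). \<Phi> ` (Q \<times> ival j i))"

text \<open>Going up, the cube grows until its generation is the top generation of the parent
  interval; then the interval is doubled and the cube kept, its generation being
  \<open>k + j = (k - 1) + (j + 1)\<close>.\<close>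

definition box_parent :: "int \<Rightarrow> int \<times> int \<times> 'a set \<Rightarrow> int \<times> int \<times> 'a set" where
  "box_parent k = (\<lambda>(j, i, Q).
     if top_gen \<kappa> (j + 1) (i div 2) < k + j then (j, i, pN (k + j) Q) else (j + 1, i div 2, Q))"

definition cells :: "int \<Rightarrow> ('a \<times> real) set set" where
  "cells k = box_set ` boxes k"

text \<open>The parent is a function of the set alone; \<open>box_set_inj\<close> shows that the set
  determines both \<open>k\<close> and the box.\<close>

definition cell_parent :: "('a \<times> real) set \<Rightarrow> ('a \<times> real) set" where
  "cell_parent P = (THE R. \<exists>k. \<exists>b\<in>boxes k. P = box_set b \<and> R = box_set (box_parent k b))"

lemma box_parent_in:
  assumes "b \<in> boxes k"
  shows "box_parent k b \<in> boxes (k - 1)"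
proof -
  obtain j i Q where b: "b = (j, i, Q)" by (metis prod_cases3)
  with assms parent[of Q "k + j"] top_gen_parent[OF \<kappa>_pos, of "j + 1" "i div 2"] show ?thesis
    by (auto simp: boxes_def box_parent_def active_def diff_add_eq)
qed

lemma box_set_subset_parent:
  assumes "b \<in> boxes k"
  shows "box_set b \<subseteq> box_set (box_parent k b)"
proof -
  obtain j i Q where b: "b = (j, i, Q)" by (metis prod_cases3)
  have "Q \<subseteq> pN (k + j) Q" using assms parent by (simp add: b boxes_def)
  then show ?thesis
    using ival_subset_parent[of j i] by (auto simp: b box_parent_def box_set_def)
qed

lemma box_set_nonempty: "b \<in> boxes k \<Longrightarrow> box_set b \<noteq> {}"
  using cube_nonempty ival_nonempty by (auto simp: boxes_def box_set_def)

lemma box_set_disjoint: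
  assumes "b \<in> boxes k" "b' \<in> boxes k" "box_set b \<inter> box_set b' \<noteq> {}"
  shows "b = b'"
proof -
  obtain j i Q j' i' Q' where b: "b = (j, i, Q)" "b' = (j', i', Q')" by (metis prod_cases3)
  with assms(3) inj obtain n t where "n \<in> Q" "n \<in> Q'" "t \<in> ival j i" "t \<in> ival j' i'"
    unfolding box_set_def by (auto simp: inj_eq[OF inj])
  with active_unique[OF \<kappa>_pos, of k j i j' i' t] assms b disjointD[OF disjoint, of Q "k + j" Q']
  show ?thesis by (auto simp: boxes_def)
qed

text \<open>The length of the interval gives the scale \<open>j\<close>, the generation of the cube
  gives \<open>k + j\<close>, and together they give \<open>k\<close>.\<close>

lemma box_set_inj:
  assumes "b \<in> boxes k" "b' \<in> boxes l" "box_set b = box_set b'"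
  shows "k = l \<and> b = b'"
proof -
  obtain j i Q j' i' Q' where b: "b = (j, i, Q)" "b' = (j', i', Q')" by (metis prod_cases3)
  have "Q \<times> ival j i = Q' \<times> ival j' i'"
    using assms(3) inj by (simp add: b box_set_def inj_image_eq_iff)
  then have "Q = Q'" "ival j i = ival j' i'"
    using assms b cube_nonempty ival_nonempty
    by (auto simp: times_eq_iff boxes_def)
  then have "j = j'" using ival_scale_inj by blast
  with \<open>Q = Q'\<close> have "k = l"
    using assms b generation_unique[of Q "k + j" "l + j"] by (auto simp: boxes_def)
  with box_set_disjoint assms box_set_nonempty show ?thesis by blast
qed

lemma cell_parent_box:
  assumes "b \<in> boxes k"
  shows "cell_parent (box_set b) = box_set (box_parent k b)"
  unfolding cell_parent_def using assms box_set_inj by (intro the_equality) blast+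

lemma disjoint_cells: "disjoint (cells k)"
  unfolding cells_def using box_set_disjoint by (intro disjointI) blast

lemma cell_parent_in: "P \<in> cells k \<Longrightarrow> cell_parent P \<in> cells (k - 1)"
  unfolding cells_def using cell_parent_box box_parent_in by auto

lemma cell_subset_parent: "P \<in> cells k \<Longrightarrow> P \<subseteq> cell_parent P"
  unfolding cells_def using cell_parent_box box_set_subset_parent by (metis imageE)

lemma cell_nonempty: "P \<in> cells k \<Longrightarrow> P \<noteq> {}"
  unfolding cells_def using box_set_nonempty by blast

lemma cell_parent_unique:
  assumes "P \<in> cells k" "R \<in> cells (k - 1)" "P \<inter> R \<noteq> {}"
  shows "R = cell_parent P"
  using disjointD[OF disjoint_cells assms(2) cell_parent_in[OF assms(1)]]
    cell_subset_parent[OF assms(1)] assms(3) by blast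

text \<open>Below the top generation of its interval a box is divided into the children of its cube,
  at most \<open>C\<^sub>1\<close> of them; at the top generation into the two halves of its
  interval, and \<open>2 \<le> C\<^sub>1\<close>.\<close>

lemma cell_children:
  assumes "P \<in> cells k"
  shows "finite {P' \<in> (\<Union>k. cells k). cell_parent P' = P} \<and>
    real (card {P' \<in> (\<Union>k. cells k). cell_parent P' = P}) \<le> C\<^sub>1"
proof -
  obtain j i Q where b: "(j, i, Q) \<in> boxes k" and P: "P = box_set (j, i, Q)"
    using assms by (auto simp: cells_def)
  then have Q: "Q \<in> \<Q> (k + j)" by (simp add: boxes_def)
  define B where "B = {b' \<in> boxes (k + 1). box_parent (k + 1) b' = (j, i, Q)}"
  have sub: "{P' \<in> (\<Union>k. cells k). cell_parent P' = P} \<subseteq> box_set ` B"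
  proof safe
    fix P' l assume P': "P' \<in> cells l" and "P = cell_parent P'"
    then obtain b' where b': "b' \<in> boxes l" "P' = box_set b'" "box_set (box_parent l b') = box_set (j, i, Q)"
      using cell_parent_box by (auto simp: cells_def P)
    with box_set_inj[OF box_parent_in b] have "l - 1 = k" "box_parent l b' = (j, i, Q)" by auto
    with b' show "P' \<in> box_set ` B" by (auto simp: B_def)
  qed
  have "finite B \<and> real (card B) \<le> C\<^sub>1"
  proof (cases "k + j < top_gen \<kappa> j i")
    case True
    have "B \<subseteq> (\<lambda>Q'. (j, i, Q')) ` cube_children \<Q> pN (k + j) Q"
    proof
      fix b' assume "b' \<in> B"
      then obtain Q' where "b' = (j, i, Q')" "Q' \<in> \<Q> (k + 1 + j)" "pN (k + 1 + j) Q' = Q"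
        using True by (auto simp: B_def boxes_def box_parent_def active_def split: if_splits)
      moreover have "k + 1 + j = k + j + 1" by simp
      ultimately show "b' \<in> (\<lambda>Q'. (j, i, Q')) ` cube_children \<Q> pN (k + j) Q"
        by (auto simp: cube_children_def)
    qed
    moreover have "finite (cube_children \<Q> pN (k + j) Q)" "real (card (cube_children \<Q> pN (k + j) Q)) \<le> C\<^sub>1"
      using children_finite[OF Q] children_le[OF Q] by auto
    ultimately show ?thesis
      using finite_surj surj_card_le by (metis (no_types, lifting) of_nat_mono order_trans)
  next
    case False
    have "i' \<in> {2 * (i' div 2), 2 * (i' div 2) + 1}" for i' :: int by auto
    then have "B \<subseteq> {(j - 1, 2 * i, Q), (j - 1, 2 * i + 1, Q)}"
      using False by (fastforce simp: B_def boxes_def box_parent_def active_def split: if_splits)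
    from finite_subset[OF this] card_mono[OF _ this] show ?thesis
      using C1 by simp
  qed
  then show ?thesis
    using finite_surj[OF _ sub] surj_card_le[OF _ sub] by force
qed


section \<open>Measure of the cells\<close>

sublocale M: sigma_finite_measure M by (rule sigma_finite)

sublocale P: pair_sigma_finite M lborel ..

lemma sets_pair: "sets (M \<Otimes>\<^sub>M lborel) = sets (borel :: ('a \<times> real) measure)"
  by (simp add: sets_M borel_prod[symmetric] cong: sets_pair_measure_cong)

lemma space_M: "space M = UNIV"
  using sets_eq_imp_space_eq[OF sets_M] by simp

lemma measurable_\<Phi>: "\<Phi> \<in> measurable (M \<Otimes>\<^sub>M lborel) borel"
  using borel_measurable_continuous_onI[OF continuous] measurable_cong_sets[OF sets_pair refl] by blast

lemma emeasure_image:
  assumes "open S"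
  shows "emeasure \<mu> (\<Phi> ` S) = emeasure (M \<Otimes>\<^sub>M lborel) S"
  using measurable_\<Phi> open_image[OF assms] inj
  by (simp add: \<mu>_eq emeasure_distr inj_vimage_image_eq space_pair_measure space_M)

lemma emeasure_box_set:
  assumes "(j, i, Q) \<in> boxes k"
  shows "emeasure \<mu> (box_set (j, i, Q)) = emeasure M Q * ennreal (2 * 2 powi j)"
proof -
  have "open Q" using assms "open" by (auto simp: boxes_def)
  then have "emeasure \<mu> (box_set (j, i, Q)) = emeasure (M \<Otimes>\<^sub>M lborel) (Q \<times> ival j i)"
    by (simp add: box_set_def emeasure_image open_Times ival_def)
  also have "\<dots> = emeasure M Q * emeasure lborel (ival j i)"
    using \<open>open Q\<close> by (intro lborel.emeasure_pair_measure_Times) (auto simp: sets_M ival_def)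
  finally show ?thesis by (simp add: emeasure_ival)
qed

text \<open>The parent also contains a disjoint sibling, which carries at least the fraction
  \<open>1 / C\<^sub>1\<close> of its measure.\<close>

lemma cube_contraction:
  assumes Q: "Q \<in> \<Q> k"
  shows "emeasure M Q \<le> ennreal (1 - 1 / C\<^sub>1) * emeasure M (pN k Q)"
proof -
  obtain Q' where Q': "Q' \<in> \<Q> k" "pN k Q' = pN k Q" "Q \<inter> Q' = {}"
    using sibling[OF Q] .
  have R: "pN k Q \<in> \<Q> (k - 1)" using parent[OF Q] by simp
  have em: "emeasure M S = ennreal (measure M S)" if "S \<in> \<Q> l" for S l
    using cube_finite[OF that] by (simp add: emeasure_eq_ennreal_measure less_top)
  have meas: "Q \<in> sets M" "Q' \<in> sets M" "pN k Q \<in> sets M"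
    using "open" Q Q' R by (auto simp: sets_M)
  have "emeasure M Q + emeasure M Q' = emeasure M (Q \<union> Q')"
    using meas Q' by (intro plus_emeasure) auto
  also have "\<dots> \<le> emeasure M (pN k Q)"
    using meas parent[OF Q] parent[OF Q'(1)] Q' by (intro emeasure_mono) auto
  finally have "measure M Q + measure M Q' \<le> measure M (pN k Q)"
    by (simp add: em[OF Q] em[OF Q'(1)] em[OF R] flip: ennreal_plus)
  moreover have "measure M (pN k Q) \<le> C\<^sub>1 * measure M Q'"
    using parent_measure[OF Q'(1)] C1 by (simp add: Q' em[OF Q'(1)] em[OF R] flip: ennreal_mult)
  then have "measure M (pN k Q) / C\<^sub>1 \<le> measure M Q'"
    using C1 by (simp add: field_simps)
  ultimately have "measure M Q \<le> (1 - 1 / C\<^sub>1) * measure M (pN k Q)"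
    by (simp add: algebra_simps)
  then show ?thesis
    using C1 by (simp add: em[OF Q] em[OF R] flip: ennreal_mult)
qed

text \<open>If the cube changes, the bounds are those for cubes. If the interval doubles, so does
  the measure, and \<open>C\<^sub>1 \<ge> 3\<close> gives both \<open>2 \<le> C\<^sub>1\<close> and
  \<open>1 \<le> 2 * (1 - 1 / C\<^sub>1)\<close>.\<close>

lemma cell_measure:
  assumes "P \<in> cells k"
  shows "emeasure \<mu> (cell_parent P) \<le> ennreal C\<^sub>1 * emeasure \<mu> P"
    and "emeasure \<mu> P \<le> ennreal (1 - 1 / C\<^sub>1) * emeasure \<mu> (cell_parent P)"
    and "0 < emeasure \<mu> P" and "emeasure \<mu> P < \<infinity>"
proof -
  obtain j i Q where b: "(j, i, Q) \<in> boxes k" and P: "P = box_set (j, i, Q)"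
    using assms by (auto simp: cells_def)
  then have Q: "Q \<in> \<Q> (k + j)" by (simp add: boxes_def)
  note eq = emeasure_box_set[OF b, folded P]
  show "0 < emeasure \<mu> P" "emeasure \<mu> P < \<infinity>"
    using cube_pos[OF Q] cube_finite[OF Q]
    by (auto simp: eq ennreal_zero_less_mult_iff ennreal_mult_less_top)
  have par: "cell_parent P = box_set (box_parent k (j, i, Q))" "box_parent k (j, i, Q) \<in> boxes (k - 1)"
    using cell_parent_box[OF b] box_parent_in[OF b] by (auto simp: P)
  have "emeasure \<mu> (cell_parent P) \<le> ennreal C\<^sub>1 * emeasure \<mu> P \<and>
      emeasure \<mu> P \<le> ennreal (1 - 1 / C\<^sub>1) * emeasure \<mu> (cell_parent P)"
  proof (cases "top_gen \<kappa> (j + 1) (i div 2) < k + j")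
    case True
    then have "emeasure \<mu> (cell_parent P) = emeasure M (pN (k + j) Q) * ennreal (2 * 2 powi j)"
      using par emeasure_box_set by (simp add: box_parent_def)
    then show ?thesis
      using parent_measure[OF Q] cube_contraction[OF Q]
      by (auto simp: eq mult.assoc[symmetric] intro: mult_right_mono)
  next
    case False
    then have "emeasure \<mu> (cell_parent P) = emeasure M Q * ennreal (2 * 2 powi (j + 1))"
      using par emeasure_box_set by (simp add: box_parent_def)
    also have "ennreal (2 * 2 powi (j + 1)) = ennreal 2 * ennreal (2 * 2 powi j)"
      unfolding powi_Suc by (rule ennreal_mult) auto
    finally have par_eq: "emeasure \<mu> (cell_parent P) = ennreal 2 * emeasure \<mu> P"
      by (simp add: eq mult_ac)
    have "1 \<le> (1 - 1 / C\<^sub>1) * 2"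
      using C1 by (simp add: field_simps)
    then have "ennreal 1 * emeasure \<mu> P \<le> ennreal ((1 - 1 / C\<^sub>1) * 2) * emeasure \<mu> P"
      by (intro mult_right_mono ennreal_leI) auto
    moreover have "ennreal ((1 - 1 / C\<^sub>1) * 2) = ennreal (1 - 1 / C\<^sub>1) * ennreal 2"
      using C1 by (intro ennreal_mult) auto
    moreover have "ennreal 2 * emeasure \<mu> P \<le> ennreal C\<^sub>1 * emeasure \<mu> P"
      using C1 by (intro mult_right_mono ennreal_leI) auto
    ultimately show ?thesis by (simp add: par_eq mult_ac)
  qed
  then show "emeasure \<mu> (cell_parent P) \<le> ennreal C\<^sub>1 * emeasure \<mu> P"
    "emeasure \<mu> P \<le> ennreal (1 - 1 / C\<^sub>1) * emeasure \<mu> (cell_parent P)" by auto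
qed

text \<open>Consecutive cells containing \<open>x\<close> are child and parent, so each step
  multiplies the measure by at most \<open>\<theta> < 1\<close>. Counted upwards from index 0 this
  gives decay; counted from \<open>k \<le> 0\<close> up to 0 it bounds \<open>m k\<close> below by
  \<open>m 0 / \<theta> ^ nat (- k)\<close>.\<close>

lemma cell_limits:
  assumes P: "\<And>k. P k \<in> cells k" "\<And>k. x \<in> P k"
  shows "((\<lambda>k. emeasure \<mu> (P k)) \<longlongrightarrow> \<infinity>) at_bot" and "((\<lambda>k. emeasure \<mu> (P k)) \<longlongrightarrow> 0) at_top"
proof -
  define \<theta> where "\<theta> = 1 - 1 / C\<^sub>1"
  have \<theta>: "0 < \<theta>" "\<theta> < 1" using C1 by (auto simp: \<theta>_def field_simps)
  define m where "m k = measure \<mu> (P k)" for k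
  have em: "emeasure \<mu> (P k) = ennreal (m k)" for k
    using cell_measure(4)[OF P(1)] by (simp add: m_def emeasure_eq_ennreal_measure less_top)
  have pos: "m k > 0" for k
    using cell_measure(3)[OF P(1)[of k]] by (simp add: em)
  have step: "m k \<le> \<theta> * m (k - 1)" for k
  proof -
    have "P (k - 1) = cell_parent (P k)"
      using cell_parent_unique[OF P(1) P(1)] P(2) by blast
    then show ?thesis
      using cell_measure(2)[OF P(1)[of k]] \<theta> pos[of "k - 1"]
      by (simp add: em \<theta>_def[symmetric] flip: \<open>P (k - 1) = cell_parent (P k)\<close> ennreal_mult)
  qed
  have decay: "m (k + int n) \<le> \<theta> ^ n * m k" for k n
  proof (induction n)
    case (Suc n)
    have "m (k + int (Suc n)) \<le> \<theta> * m (k + int n)"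
      using step[of "k + int (Suc n)"] by simp
    also have "\<dots> \<le> \<theta> * (\<theta> ^ n * m k)"
      using Suc \<theta> by simp
    finally show ?case by simp
  qed simp
  have pow: "(\<lambda>n. \<theta> ^ n) \<longlonglongrightarrow> 0" using \<theta> by (intro LIMSEQ_realpow_zero) auto
  from tendsto_mult_left_zero[OF filterlim_compose[OF this filterlim_nat_sequentially], of "m 0"]
  have lim: "((\<lambda>k. \<theta> ^ nat k * m 0) \<longlongrightarrow> 0) at_top" .
  have ev: "eventually (\<lambda>k. m k \<le> \<theta> ^ nat k * m 0) at_top"
  proof (rule eventually_at_top_linorderI[of 0])
    fix k :: int assume "0 \<le> k"
    then show "m k \<le> \<theta> ^ nat k * m 0" using decay[of 0 "nat k"] by simp
  qed
  have "(m \<longlongrightarrow> 0) at_top"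
    by (rule tendsto_sandwich[OF _ ev tendsto_const lim]) (simp add: pos less_imp_le)
  then show "((\<lambda>k. emeasure \<mu> (P k)) \<longlongrightarrow> 0) at_top"
    unfolding em using tendsto_ennrealI[of m 0] by simp
  have "filterlim (\<lambda>n. inverse (\<theta> ^ n)) at_top sequentially"
    using \<theta> by (intro filterlim_inverse_at_top[OF pow]) auto
  then have "filterlim (\<lambda>n. m 0 * inverse (\<theta> ^ n)) at_top sequentially"
    by (rule filterlim_tendsto_pos_mult_at_top[OF tendsto_const pos])
  moreover have "filterlim (\<lambda>k::int. nat (- k)) sequentially at_bot"
    unfolding filterlim_at_top
  proof
    fix n :: nat
    show "eventually (\<lambda>k::int. n \<le> nat (- k)) at_bot"
      by (rule eventually_at_bot_linorderI[of "- int n"]) simp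
  qed
  ultimately have "filterlim (\<lambda>k. m 0 * inverse (\<theta> ^ nat (- k))) at_top at_bot"
    by (rule filterlim_compose)
  then have "filterlim m at_top at_bot"
  proof (rule filterlim_at_top_mono)
    show "eventually (\<lambda>k. m 0 * inverse (\<theta> ^ nat (- k)) \<le> m k) at_bot"
    proof (rule eventually_at_bot_linorderI[of 0])
      fix k :: int assume "k \<le> 0"
      then show "m 0 * inverse (\<theta> ^ nat (- k)) \<le> m k"
        using decay[of k "nat (- k)"] \<theta> by (simp add: field_simps)
    qed
  qed
  then show "((\<lambda>k. emeasure \<mu> (P k)) \<longlongrightarrow> \<infinity>) at_bot"
    unfolding em by (simp add: ennreal_tendsto_top_eq_at_top)
qed

section \<open>Covering up to null sets, and admissibility of the cells\<close>

lemma open_cells: "open (\<Union>(cells k))"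
  using "open" by (auto simp: cells_def boxes_def box_set_def ival_def intro!: open_image open_Times)

lemma sets_\<mu>: "sets \<mu> = sets borel"
  by (simp add: \<mu>_eq)

lemma AE_cells: "AE x in \<mu>. \<forall>k. x \<in> \<Union>(cells k)"
  unfolding AE_all_countable
proof
  fix k
  \<comment> \<open>The exceptional points are those missed by the cubes of some generation and, in
    \<open>T\<^sub>0\<close>, the dyadic end points of all scales.\<close>
  define N\<^sub>0 where "N\<^sub>0 = (\<Union>g. UNIV - \<Union>(\<Q> g))"
  define T\<^sub>0 where "T\<^sub>0 = range (\<lambda>(i, j). 2 * of_int i * 2 powi j :: real)"
  have "\<Union>(\<Q> g) \<in> sets borel" for g
    using "open" by (intro borel_open open_Union) auto
  then have N0: "N\<^sub>0 \<in> null_sets M"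
    unfolding N\<^sub>0_def by (intro null_sets_UN null_setsI covering) (simp add: sets_M)
  have T0: "T\<^sub>0 \<in> null_sets lborel"
    unfolding T\<^sub>0_def by (intro countable_imp_null_set_lborel) simp
  have "\<Phi> (n, t) \<in> \<Union>(cells k)" if nt: "n \<notin> N\<^sub>0" "t \<notin> T\<^sub>0" for n t
  proof -
    obtain j where j: "active \<kappa> k j (index j t)" using active_ex[OF \<kappa>_pos] by blast
    obtain Q where Q: "Q \<in> \<Q> (k + j)" "n \<in> Q" using nt(1) unfolding N\<^sub>0_def by blast
    have "t \<in> ival j (index j t)"
      using nt(2) by (intro in_ival_index) (auto simp: T\<^sub>0_def)
    then have "\<Phi> (n, t) \<in> box_set (j, index j t, Q)" using Q by (auto simp: box_set_def)
    moreover have "(j, index j t, Q) \<in> boxes k" using j Q by (simp add: boxes_def)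
    ultimately show ?thesis by (auto simp: cells_def)
  qed
  then have sub: "{y. \<Phi> y \<notin> \<Union>(cells k)} \<subseteq> N\<^sub>0 \<times> UNIV \<union> UNIV \<times> T\<^sub>0" by force
  have "N\<^sub>0 \<times> UNIV \<in> null_sets (M \<Otimes>\<^sub>M lborel)"
    using N0 by (intro lborel.times_in_null_sets1) auto
  moreover have "UNIV \<times> T\<^sub>0 \<in> null_sets (M \<Otimes>\<^sub>M lborel)"
    using T0 by (intro lborel.times_in_null_sets2) (auto simp: sets_M)
  ultimately have "N\<^sub>0 \<times> UNIV \<union> UNIV \<times> T\<^sub>0 \<in> null_sets (M \<Otimes>\<^sub>M lborel)"
    by (rule null_sets.Un)
  then have "AE y in M \<Otimes>\<^sub>M lborel. \<Phi> y \<in> \<Union>(cells k)"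
    by (rule AE_I') (use sub in auto)
  moreover have "{x \<in> space borel. x \<in> \<Union>(cells k)} \<in> sets borel"
    using borel_open[OF open_cells, of k] by (simp del: Union_iff)
  ultimately show "AE x in \<mu>. x \<in> \<Union>(cells k)"
    unfolding \<mu>_eq by (simp add: AE_distr_iff[OF measurable_\<Phi>] del: Union_iff)
qed

lemma null_complement: "G_set - \<Union>(cells k) \<in> null_sets \<mu>"
proof -
  have "open (G_set :: ('a \<times> real) set)"
    unfolding G_set_def by (intro open_Times) auto
  then have "G_set - \<Union>(cells k) \<in> sets \<mu>"
    using open_cells by (auto simp: sets_\<mu>)
  then show ?thesis
    using AE_cells by (subst AE_iff_null_sets) auto
qed

text \<open>A cell is the cylinder for which \<open>ln a\<close> is the centre and
  \<open>ln r\<close> the half-length of its interval, as in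
  \<open>active_admissible\<close>.\<close>

lemma cells_admissible:
  assumes \<gamma>: "\<gamma> \<ge> 5" and lam: "lam > exp 3 / \<delta>"
    and cylinder: "\<And>r Q a. cylinder N Z r Q a = \<Phi> ` (Q \<times> {ln (a / r)<..<ln (a * r)})"
  shows "cells k \<subseteq> admissible_cylinders N Z \<Q> \<delta> \<gamma> lam"
proof
  fix P assume "P \<in> cells k"
  then obtain j i Q where act: "active \<kappa> k j i" and Q: "Q \<in> \<Q> (k + j)" and P: "P = box_set (j, i, Q)"
    by (auto simp: cells_def boxes_def)
  let ?r = "exp (2 powi j) :: real" and ?a = "exp ((2 * of_int i + 1) * 2 powi j) :: real"
  have "{ln (?a / ?r)<..<ln (?a * ?r)} = ival j i"
    by (simp add: ival_def algebra_simps flip: exp_diff exp_add)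
  then have "P = cylinder N Z ?r Q ?a"
    by (simp add: P box_set_def cylinder)
  then show "P \<in> admissible_cylinders N Z \<Q> \<delta> \<gamma> lam"
    unfolding admissible_cylinders_def
    using active_admissible[OF delta \<gamma> lam act[unfolded \<kappa>_def]] Q
    by (intro CollectI exI[of _ ?r] exI[of _ Q] exI[of _ ?a] exI[of _ "k + j"]) auto
qed

end


section \<open>The cells in the flow coordinates of the group\<close>

theorem theorem3p9:
  fixes N :: "'a::euclidean_space stratified"
    and Z :: "'a \<times> real" and \<mu> :: "('a \<times> real) measure"
    and \<Q> :: "int \<Rightarrow> 'a set set" and pN :: "int \<Rightarrow> 'a set \<Rightarrow> 'a set"
    and \<delta> C\<^sub>1 c \<gamma> lam :: real
  assumes "stratified_group N"
    and "Z \<in> Z_set N"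
    and "\<mu> \<in> doubling_flow_measures N Z"
    and "christ_cubes N (slice_measure N Z \<mu>) \<Q> pN \<delta> C\<^sub>1 c"
    and "\<gamma> \<ge> 5" and "lam > exp 3 / \<delta>"
  shows "\<exists>(D :: int \<Rightarrow> ('a \<times> real) set set) (p :: ('a \<times> real) set \<Rightarrow> ('a \<times> real) set).
     (\<forall>k. D k \<subseteq> admissible_cylinders N Z \<Q> \<delta> \<gamma> lam \<and> disjoint (D k)) \<and>
     (\<forall>k. G_set - \<Union>(D k) \<in> null_sets \<mu>) \<and>
     (\<forall>k. \<forall>P\<in>D k. (\<exists>!R. R \<in> D (k - 1) \<and> P \<subseteq> R) \<and> p P \<in> D (k - 1) \<and> P \<subseteq> p P \<and>
        (\<forall>P'\<in>D (k - 1). P' \<noteq> p P \<longrightarrow> P \<inter> P' = {})) \<and>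
     (AE x in \<mu>. \<forall>k. \<exists>!P. P \<in> D k \<and> x \<in> P) \<and>
     (\<forall>x\<in>G_set. \<forall>P. (\<forall>k. P k \<in> D k \<and> x \<in> P k) \<longrightarrow>
        ((\<lambda>k. emeasure \<mu> (P k)) \<longlongrightarrow> \<infinity>) at_bot \<and>
        ((\<lambda>k. emeasure \<mu> (P k)) \<longlongrightarrow> 0) at_top) \<and>
     (\<forall>P\<in>(\<Union>k. D k). emeasure \<mu> (p P) \<le> ennreal C\<^sub>1 * emeasure \<mu> P \<and>
        finite {P' \<in> (\<Union>k. D k). p P' = P} \<and> real (card {P' \<in> (\<Union>k. D k). p P' = P}) \<le> C\<^sub>1)"
proof -
  interpret stratified_group N by fact
  interpret christ_cubes N "slice_measure N Z \<mu>" \<Q> pN \<delta> C\<^sub>1 c by fact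
  let ?M = "slice_measure N Z \<mu>"
  define \<phi> where "\<phi> = (SOME \<phi>. flow_density N Z \<mu> \<phi>)"
  have dens: "flow_density N Z \<mu> \<phi>"
    using assms(3) someI_ex[of "flow_density N Z \<mu>"]
    unfolding \<phi>_def doubling_flow_measures_def flow_measure_def by blast
  have M: "?M = density lborel (\<lambda>n. ennreal (\<phi> (n, 1)))"
    by (simp add: slice_measure_def \<phi>_def)
  obtain m where m: "\<And>n t. gmul N (n, 1) (exp_G N (t *\<^sub>R Z)) = flow m (n, t)"
    using obtain_flow[OF assms(2)] by blast
  have "\<phi> \<in> borel_measurable borel" using dens by (simp add: flow_density_def)
  then have "(\<lambda>n. \<phi> (n, 1)) \<in> borel_measurable borel"
    by (rule measurable_compose[rotated])
      (intro borel_measurable_continuous_onI continuous_intros)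
  then have "(\<lambda>n. ennreal (\<phi> (n, 1))) \<in> borel_measurable lborel"
    by simp
  from sigma_finite_measure.sigma_finite_iff_density_finite[OF sigma_finite_lborel this]
  have sigma: "sigma_finite_measure ?M"
    by (simp add: M)
  have ball: "0 < emeasure ?M (cc_ball N x r)" "emeasure ?M (cc_ball N x r) < \<infinity>" if "r > 0" for x r
    using assms(3) that by (auto simp: doubling_flow_measures_def doubling_def)
  \<comment> \<open>\<open>emeasure\<close> is 0 off the sigma-algebra, so positivity of the measure
    of a ball forces the ball to be measurable.\<close>
  have ball_sets: "cc_ball N x r \<in> sets ?M" if "r > 0" for x r
    using ball(1)[OF that, of x] emeasure_notin_sets by fastforce
  \<comment> \<open>The inner ball of the cube gives positivity and the outer one
    finiteness.\<close>
  have cube: "0 < emeasure ?M Q \<and> emeasure ?M Q < \<infinity>" if Q: "Q \<in> \<Q> k" for Q k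
  proof -
    obtain n where n: "cc_ball N n (c * \<delta> powi k) \<subseteq> Q" "Q \<subseteq> cc_ball N n (C\<^sub>1 * \<delta> powi k)"
      using balls[OF Q] by blast
    have r: "c * \<delta> powi k > 0" "C\<^sub>1 * \<delta> powi k > 0"
      using c C1 delta by auto
    have "Q \<in> sets ?M" using "open"[OF Q] by (simp add: M)
    then show ?thesis
      using ball(1)[OF r(1), of n] ball(2)[OF r(2), of n]
        emeasure_mono[OF n(1)] emeasure_mono[OF n(2) ball_sets[OF r(2)]]
      by (meson le_less_trans less_le_trans)
  qed
  interpret cube_flow N ?M \<Q> pN \<delta> C\<^sub>1 c "flow m" \<mu>
  proof (intro cube_flow.intro cube_flow_axioms.intro)
    show "\<mu> = distr (?M \<Otimes>\<^sub>M lborel) borel (flow m)"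
      unfolding M by (rule flow_density_eq_distr[OF dens m])
    show "0 < emeasure ?M Q" "emeasure ?M Q < \<infinity>" if "Q \<in> \<Q> k" for Q k
      using cube[OF that] by auto
    show "open (flow m ` S)" if "open S" for S
      using that by (rule open_flow_image)
    show "sigma_finite_measure ?M" "sets ?M = sets borel"
      using sigma by (simp_all add: M)
  qed (rule assms(4) inj_flow continuous_flow)+
  have cyl: "cylinder N Z r Q a = flow m ` (Q \<times> {ln (a / r)<..<ln (a * r)})" for r Q a
    unfolding cylinder_def m by blast
  show ?thesis
  proof (intro exI[of _ cells] exI[of _ cell_parent] conjI allI ballI impI)
    fix k
    show "cells k \<subseteq> admissible_cylinders N Z \<Q> \<delta> \<gamma> lam"
      using cells_admissible[OF assms(5,6) cyl] .
    show "disjoint (cells k)" by (rule disjoint_cells)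
    show "G_set - \<Union>(cells k) \<in> null_sets \<mu>" by (rule null_complement)
  next
    fix k P assume P: "P \<in> cells k"
    show in_par: "cell_parent P \<in> cells (k - 1)" "P \<subseteq> cell_parent P"
      using P cell_parent_in cell_subset_parent by auto
    show disj: "P \<inter> P' = {}" if "P' \<in> cells (k - 1)" "P' \<noteq> cell_parent P" for P'
      using that cell_parent_unique[OF P] by blast
    show "\<exists>!R. R \<in> cells (k - 1) \<and> P \<subseteq> R"
      using in_par disj cell_nonempty[OF P] by (metis inf.absorb1)
  next
    show "AE x in \<mu>. \<forall>k. \<exists>!P. P \<in> cells k \<and> x \<in> P"
      using AE_cells
    proof (rule AE_mp, intro AE_I2 impI allI)
      fix x k assume "\<forall>k. x \<in> \<Union>(cells k)"
      then show "\<exists>!P. P \<in> cells k \<and> x \<in> P"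
        using disjointD[OF disjoint_cells] by blast
    qed
  next
    fix x P assume P: "\<forall>k. P k \<in> cells k \<and> x \<in> P k"
    then show "((\<lambda>k. emeasure \<mu> (P k)) \<longlongrightarrow> \<infinity>) at_bot" "((\<lambda>k. emeasure \<mu> (P k)) \<longlongrightarrow> 0) at_top"
      using cell_limits[of P x] by auto
  next
    fix P assume "P \<in> (\<Union>k. cells k)"
    then obtain k where P: "P \<in> cells k" by blast
    show "emeasure \<mu> (cell_parent P) \<le> ennreal C\<^sub>1 * emeasure \<mu> P"
      using cell_measure(1)[OF P] .
    show "finite {P' \<in> (\<Union>k. cells k). cell_parent P' = P}"
      "real (card {P' \<in> (\<Union>k. cells k). cell_parent P' = P}) \<le> C\<^sub>1"
      using cell_children[OF P] by auto
  qed
qed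

end
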